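(* Judgmental equality in Martin-Löf type theory with extensional identity types, $\Pi$-types and one base type $o$ is undecidable: there is no algorithm which, given a context $\Gamma$, a type $A$ and terms $M,M'$ such that $\Gamma\vdash M:A$ and $\Gamma\vdash M':A$ are derivable, decides whether $\Gamma\vdash M=M':A$ is derivable.
   Context: Judgments: $\Gamma\vdash$ (well-formed context), $\Gamma\vdash A$, $\Gamma\vdash A=A'$, $\Gamma\vdash a:A$, $\Gamma\vdash a=a':A$, with the usual structural rules of dependent type theory (context formation, variables, weakening, substitution, equality is an equivalence relation and a congruence for all operations, conversion of terms along type equality). Base type: $\Gamma\vdash o$ in every well-formed context, with no further rules for $o$. $\Pi$-types: the usual formation, $\lambda$-abstraction and application rules, with $\beta$ and $\eta$ as judgmental equalities. Extensional identity types: formation $\Gamma\vdash \mathrm{I}(A,a,a')$ when $\Gamma\vdash a:A$ and $\Gamma\vdash a':A$; introduction $\Gamma\vdash \mathrm{r}(a):\mathrm{I}(A,a,a)$; and from $\Gamma\vdash c:\mathrm{I}(A,a,a')$ infer $\Gamma\vdash a=a':A$ and $\Gamma\vdash c=\mathrm{r}(a):\mathrm{I}(A,a,a')$. *)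

theory Defs
  imports Main "HOL-Library.Nat_Bijection"
begin

section \<open>Raw syntax\<close>

text \<open>
  De Bruijn indices. Lambda abstraction, application and \<open>Refl\<close> carry no type annotations,
  in the style of the notation \<open>r(a)\<close>; equality of terms is always judged at a type.
\<close>

datatype tm = Var nat | Lam tm | App tm tm | Refl tm

text \<open>In \<open>TPi A B\<close> the type \<open>B\<close> has one extra variable, with index \<open>0\<close>.\<close>

datatype ty = TBase | TPi ty ty | TId ty tm tm

text \<open>The head of the list is the most recently declared variable.\<close>

type_synonym ctx = "ty list"

text \<open>\<open>lift_tm c t\<close> inserts a fresh variable at index \<open>c\<close>.\<close>

primrec lift_tm :: "nat \<Rightarrow> tm \<Rightarrow> tm" where
  "lift_tm c (Var i) = (if i < c then Var i else Var (Suc i))"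
| "lift_tm c (Lam t) = Lam (lift_tm (Suc c) t)"
| "lift_tm c (App t u) = App (lift_tm c t) (lift_tm c u)"
| "lift_tm c (Refl t) = Refl (lift_tm c t)"

primrec lift_ty :: "nat \<Rightarrow> ty \<Rightarrow> ty" where
  "lift_ty c TBase = TBase"
| "lift_ty c (TPi A B) = TPi (lift_ty c A) (lift_ty (Suc c) B)"
| "lift_ty c (TId A t u) = TId (lift_ty c A) (lift_tm c t) (lift_tm c u)"

text \<open>
  \<open>subst_tm k s t\<close> replaces variable \<open>k\<close> of \<open>t\<close> by \<open>s\<close> and removes it from the context. The term
  \<open>s\<close> lives in the context below variable \<open>k\<close>, hence is lifted over the \<open>k\<close> variables above.
\<close>

primrec subst_tm :: "nat \<Rightarrow> tm \<Rightarrow> tm \<Rightarrow> tm" where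
  "subst_tm k s (Var i) =
     (if i < k then Var i else if i = k then (lift_tm 0 ^^ k) s else Var (i - 1))"
| "subst_tm k s (Lam t) = Lam (subst_tm (Suc k) s t)"
| "subst_tm k s (App t u) = App (subst_tm k s t) (subst_tm k s u)"
| "subst_tm k s (Refl t) = Refl (subst_tm k s t)"

primrec subst_ty :: "nat \<Rightarrow> tm \<Rightarrow> ty \<Rightarrow> ty" where
  "subst_ty k s TBase = TBase"
| "subst_ty k s (TPi A B) = TPi (subst_ty k s A) (subst_ty (Suc k) s B)"
| "subst_ty k s (TId A t u) = TId (subst_ty k s A) (subst_tm k s t) (subst_tm k s u)"

text \<open>
  A context extending \<open>\<Gamma>\<close> is written \<open>\<Delta> @ \<Gamma>\<close>; the following act on the segment \<open>\<Delta>\<close> when a variable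
  is inserted, respectively substituted, directly above \<open>\<Gamma>\<close>.
\<close>

primrec lift_tel :: "ctx \<Rightarrow> ctx" where
  "lift_tel [] = []"
| "lift_tel (D # \<Delta>) = lift_ty (length \<Delta>) D # lift_tel \<Delta>"

primrec subst_tel :: "tm \<Rightarrow> ctx \<Rightarrow> ctx" where
  "subst_tel s [] = []"
| "subst_tel s (D # \<Delta>) = subst_ty (length \<Delta>) s D # subst_tel s \<Delta>"


section \<open>Judgments and derivability\<close>

datatype jdg = IsCtx | IsTy ty | EqTy ty ty | IsTm tm ty | EqTm tm tm ty

primrec lift_jd :: "nat \<Rightarrow> jdg \<Rightarrow> jdg" where
  "lift_jd c IsCtx = IsCtx"
| "lift_jd c (IsTy A) = IsTy (lift_ty c A)"
| "lift_jd c (EqTy A B) = EqTy (lift_ty c A) (lift_ty c B)"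
| "lift_jd c (IsTm a A) = IsTm (lift_tm c a) (lift_ty c A)"
| "lift_jd c (EqTm a b A) = EqTm (lift_tm c a) (lift_tm c b) (lift_ty c A)"

primrec subst_jd :: "nat \<Rightarrow> tm \<Rightarrow> jdg \<Rightarrow> jdg" where
  "subst_jd k s IsCtx = IsCtx"
| "subst_jd k s (IsTy A) = IsTy (subst_ty k s A)"
| "subst_jd k s (EqTy A B) = EqTy (subst_ty k s A) (subst_ty k s B)"
| "subst_jd k s (IsTm a A) = IsTm (subst_tm k s a) (subst_ty k s A)"
| "subst_jd k s (EqTm a b A) = EqTm (subst_tm k s a) (subst_tm k s b) (subst_ty k s A)"

inductive derivable :: "ctx \<Rightarrow> jdg \<Rightarrow> bool" (infix "\<turnstile>" 50) where
  ctx_empty: "[] \<turnstile> IsCtx"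
| ctx_ext: "\<Gamma> \<turnstile> IsTy A \<Longrightarrow> A # \<Gamma> \<turnstile> IsCtx"
| var: "\<Gamma> \<turnstile> IsCtx \<Longrightarrow> i < length \<Gamma> \<Longrightarrow> \<Gamma> \<turnstile> IsTm (Var i) ((lift_ty 0 ^^ Suc i) (\<Gamma> ! i))"
| weaken: "\<Delta> @ \<Gamma> \<turnstile> J \<Longrightarrow> \<Gamma> \<turnstile> IsTy A \<Longrightarrow> lift_tel \<Delta> @ A # \<Gamma> \<turnstile> lift_jd (length \<Delta>) J"
| subst: "\<Delta> @ A # \<Gamma> \<turnstile> J \<Longrightarrow> \<Gamma> \<turnstile> IsTm a A \<Longrightarrow> subst_tel a \<Delta> @ \<Gamma> \<turnstile> subst_jd (length \<Delta>) a J"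
| subst_ty_cong: "\<Delta> @ A # \<Gamma> \<turnstile> IsTy B \<Longrightarrow> \<Gamma> \<turnstile> IsTm a A \<Longrightarrow> \<Gamma> \<turnstile> IsTm a' A \<Longrightarrow> \<Gamma> \<turnstile> EqTm a a' A \<Longrightarrow>
    subst_tel a \<Delta> @ \<Gamma> \<turnstile> EqTy (subst_ty (length \<Delta>) a B) (subst_ty (length \<Delta>) a' B)"
| subst_tm_cong: "\<Delta> @ A # \<Gamma> \<turnstile> IsTm b B \<Longrightarrow> \<Gamma> \<turnstile> IsTm a A \<Longrightarrow> \<Gamma> \<turnstile> IsTm a' A \<Longrightarrow> \<Gamma> \<turnstile> EqTm a a' A \<Longrightarrow>
    subst_tel a \<Delta> @ \<Gamma> \<turnstile>
      EqTm (subst_tm (length \<Delta>) a b) (subst_tm (length \<Delta>) a' b) (subst_ty (length \<Delta>) a B)"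
| ty_refl: "\<Gamma> \<turnstile> IsTy A \<Longrightarrow> \<Gamma> \<turnstile> EqTy A A"
| ty_sym: "\<Gamma> \<turnstile> EqTy A B \<Longrightarrow> \<Gamma> \<turnstile> EqTy B A"
| ty_trans: "\<Gamma> \<turnstile> EqTy A B \<Longrightarrow> \<Gamma> \<turnstile> EqTy B C \<Longrightarrow> \<Gamma> \<turnstile> EqTy A C"
| tm_refl: "\<Gamma> \<turnstile> IsTm a A \<Longrightarrow> \<Gamma> \<turnstile> EqTm a a A"
| tm_sym: "\<Gamma> \<turnstile> EqTm a b A \<Longrightarrow> \<Gamma> \<turnstile> EqTm b a A"
| tm_trans: "\<Gamma> \<turnstile> EqTm a b A \<Longrightarrow> \<Gamma> \<turnstile> EqTm b c A \<Longrightarrow> \<Gamma> \<turnstile> EqTm a c A"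
| conv_tm: "\<Gamma> \<turnstile> IsTm a A \<Longrightarrow> \<Gamma> \<turnstile> EqTy A B \<Longrightarrow> \<Gamma> \<turnstile> IsTm a B"
| conv_eq: "\<Gamma> \<turnstile> EqTm a b A \<Longrightarrow> \<Gamma> \<turnstile> EqTy A B \<Longrightarrow> \<Gamma> \<turnstile> EqTm a b B"
| base_form: "\<Gamma> \<turnstile> IsCtx \<Longrightarrow> \<Gamma> \<turnstile> IsTy TBase"
| pi_form: "\<Gamma> \<turnstile> IsTy A \<Longrightarrow> A # \<Gamma> \<turnstile> IsTy B \<Longrightarrow> \<Gamma> \<turnstile> IsTy (TPi A B)"
| pi_form_cong: "\<Gamma> \<turnstile> EqTy A A' \<Longrightarrow> A # \<Gamma> \<turnstile> EqTy B B' \<Longrightarrow> \<Gamma> \<turnstile> EqTy (TPi A B) (TPi A' B')"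
| lam: "A # \<Gamma> \<turnstile> IsTm b B \<Longrightarrow> \<Gamma> \<turnstile> IsTm (Lam b) (TPi A B)"
| lam_cong: "A # \<Gamma> \<turnstile> EqTm b b' B \<Longrightarrow> \<Gamma> \<turnstile> EqTm (Lam b) (Lam b') (TPi A B)"
| app: "\<Gamma> \<turnstile> IsTm c (TPi A B) \<Longrightarrow> \<Gamma> \<turnstile> IsTm a A \<Longrightarrow> \<Gamma> \<turnstile> IsTm (App c a) (subst_ty 0 a B)"
| app_cong: "\<Gamma> \<turnstile> EqTm c c' (TPi A B) \<Longrightarrow> \<Gamma> \<turnstile> EqTm a a' A \<Longrightarrow>
    \<Gamma> \<turnstile> EqTm (App c a) (App c' a') (subst_ty 0 a B)"
| beta: "A # \<Gamma> \<turnstile> IsTm b B \<Longrightarrow> \<Gamma> \<turnstile> IsTm a A \<Longrightarrow>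
    \<Gamma> \<turnstile> EqTm (App (Lam b) a) (subst_tm 0 a b) (subst_ty 0 a B)"
| eta: "\<Gamma> \<turnstile> IsTm c (TPi A B) \<Longrightarrow> \<Gamma> \<turnstile> EqTm c (Lam (App (lift_tm 0 c) (Var 0))) (TPi A B)"
| id_form: "\<Gamma> \<turnstile> IsTm a A \<Longrightarrow> \<Gamma> \<turnstile> IsTm a' A \<Longrightarrow> \<Gamma> \<turnstile> IsTy (TId A a a')"
| id_form_cong: "\<Gamma> \<turnstile> EqTy A B \<Longrightarrow> \<Gamma> \<turnstile> EqTm a b A \<Longrightarrow> \<Gamma> \<turnstile> EqTm a' b' A \<Longrightarrow>
    \<Gamma> \<turnstile> EqTy (TId A a a') (TId B b b')"
| id_intro: "\<Gamma> \<turnstile> IsTm a A \<Longrightarrow> \<Gamma> \<turnstile> IsTm (Refl a) (TId A a a)"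
| id_intro_cong: "\<Gamma> \<turnstile> EqTm a b A \<Longrightarrow> \<Gamma> \<turnstile> EqTm (Refl a) (Refl b) (TId A a a)"
| id_reflect: "\<Gamma> \<turnstile> IsTm c (TId A a a') \<Longrightarrow> \<Gamma> \<turnstile> EqTm a a' A"
| id_unique: "\<Gamma> \<turnstile> IsTm c (TId A a a') \<Longrightarrow> \<Gamma> \<turnstile> EqTm c (Refl a) (TId A a a')"


section \<open>Algorithms: partial recursive functions\<close>

datatype recf =
    Zero
  | Succ
  | Proj nat
  | Comp recf "recf list"
  | PrimRec recf recf
  | Mu recf

text \<open>\<open>has_arity f n\<close>: \<open>f\<close> is a well-formed description of an \<open>n\<close>-ary partial function.\<close>

inductive has_arity :: "recf \<Rightarrow> nat \<Rightarrow> bool" where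
  "has_arity Zero n"
| "has_arity Succ 1"
| "i < n \<Longrightarrow> has_arity (Proj i) n"
| "has_arity f (length gs) \<Longrightarrow> (\<And>g. g \<in> set gs \<Longrightarrow> has_arity g n) \<Longrightarrow> has_arity (Comp f gs) n"
| "has_arity f n \<Longrightarrow> has_arity g (Suc (Suc n)) \<Longrightarrow> has_arity (PrimRec f g) (Suc n)"
| "has_arity f (Suc n) \<Longrightarrow> has_arity (Mu f) n"

text \<open>
  \<open>rec_eval f xs y\<close>: \<open>f\<close> halts on arguments \<open>xs\<close> with value \<open>y\<close>. The recursion variable of
  \<open>PrimRec\<close> and the search variable of \<open>Mu\<close> come first.
\<close>

inductive rec_eval :: "recf \<Rightarrow> nat list \<Rightarrow> nat \<Rightarrow> bool" where
  rec_eval_Zero: "rec_eval Zero xs 0"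
| rec_eval_Succ: "rec_eval Succ [x] (Suc x)"
| rec_eval_Proj: "i < length xs \<Longrightarrow> rec_eval (Proj i) xs (xs ! i)"
| rec_eval_Comp: "list_all2 (\<lambda>g y. rec_eval g xs y) gs ys \<Longrightarrow> rec_eval f ys z \<Longrightarrow>
    rec_eval (Comp f gs) xs z"
| rec_eval_PrimRec_0: "rec_eval f xs y \<Longrightarrow> rec_eval (PrimRec f g) (0 # xs) y"
| rec_eval_PrimRec_Suc: "rec_eval (PrimRec f g) (n # xs) y \<Longrightarrow> rec_eval g (n # y # xs) z \<Longrightarrow>
    rec_eval (PrimRec f g) (Suc n # xs) z"
| rec_eval_Mu: "rec_eval f (n # xs) 0 \<Longrightarrow> (\<And>m. m < n \<Longrightarrow> \<exists>y. rec_eval f (m # xs) (Suc y)) \<Longrightarrow>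
    rec_eval (Mu f) xs n"

lemma rec_eval_deterministic:
  assumes "rec_eval f xs y" and "rec_eval f xs z"
  shows "y = z"
  using assms
proof (induction arbitrary: z rule: rec_eval.induct)
  case (rec_eval_Comp xs gs ys f w)
  from rec_eval_Comp.prems obtain zs where
    zs: "list_all2 (\<lambda>g y. rec_eval g xs y) gs zs" "rec_eval f zs z"
    by (cases rule: rec_eval.cases) auto
  have "ys = zs"
    using rec_eval_Comp.IH(1) zs(1)
    by (auto simp: list_all2_conv_all_nth intro!: nth_equalityI)
  with rec_eval_Comp.IH(2) zs(2) show ?case by simp
next
  case (rec_eval_PrimRec_0 f xs y g)
  from rec_eval_PrimRec_0.prems have "rec_eval f xs z"
    by (cases rule: rec_eval.cases) auto
  then show ?case by (rule rec_eval_PrimRec_0.IH)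
next
  case (rec_eval_PrimRec_Suc f g n xs y w)
  from rec_eval_PrimRec_Suc.prems obtain u where
    "rec_eval (PrimRec f g) (n # xs) u" "rec_eval g (n # u # xs) z"
    by (cases rule: rec_eval.cases) auto
  with rec_eval_PrimRec_Suc.IH show ?case by metis
next
  case (rec_eval_Mu f n xs)
  from rec_eval_Mu.prems have z: "rec_eval f (z # xs) 0"
    "\<And>m. m < z \<Longrightarrow> \<exists>y. rec_eval f (m # xs) (Suc y)"
    by (cases rule: rec_eval.cases; simp)+
  show ?case
  proof (cases n z rule: linorder_cases)
    case less
    with z(2) rec_eval_Mu.IH(1) show ?thesis by blast
  next
    case greater
    with z(1) rec_eval_Mu.IH(2) show ?thesis by blast
  qed
qed (auto elim: rec_eval.cases)


section \<open>Goedel numbering\<close>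

text \<open>
  Explicit pairing, so that constructors and destructors of the syntax are computable on codes
  (the unspecified encodings of the class \<open>countable\<close> would not ensure this).
\<close>

primrec code_tm :: "tm \<Rightarrow> nat" where
  "code_tm (Var i) = prod_encode (0, i)"
| "code_tm (Lam t) = prod_encode (1, code_tm t)"
| "code_tm (App t u) = prod_encode (2, prod_encode (code_tm t, code_tm u))"
| "code_tm (Refl t) = prod_encode (3, code_tm t)"

primrec code_ty :: "ty \<Rightarrow> nat" where
  "code_ty TBase = prod_encode (0, 0)"
| "code_ty (TPi A B) = prod_encode (1, prod_encode (code_ty A, code_ty B))"
| "code_ty (TId A t u) =
     prod_encode (2, prod_encode (code_ty A, prod_encode (code_tm t, code_tm u)))"

definition code_ctx :: "ctx \<Rightarrow> nat" where
  "code_ctx \<Gamma> = list_encode (map code_ty \<Gamma>)"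

lemma code_tm_inject: "code_tm t = code_tm u \<longleftrightarrow> t = u"
proof (induction t arbitrary: u)
  case (Var i) then show ?case by (cases u) auto
next
  case (Lam t) then show ?case by (cases u) auto
next
  case (App t1 t2) then show ?case by (cases u) auto
next
  case (Refl t) then show ?case by (cases u) auto
qed

lemma code_ty_inject: "code_ty A = code_ty B \<longleftrightarrow> A = B"
proof (induction A arbitrary: B)
  case TBase then show ?case by (cases B) auto
next
  case (TPi A1 A2) then show ?case by (cases B) auto
next
  case (TId A t u) then show ?case by (cases B) (auto simp: code_tm_inject)
qed

lemma code_ctx_inject: "code_ctx \<Gamma> = code_ctx \<Delta> \<longleftrightarrow> \<Gamma> = \<Delta>"
proof -
  have "inj code_ty" by (simp add: inj_def code_ty_inject)
  then show ?thesis by (simp add: code_ctx_def list_encode_eq inj_map_eq_map)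
qed


section \<open>Deciding judgmental equality\<close>

text \<open>
  A promise problem: nothing is required of \<open>f\<close> on inputs other than codes of two terms of the
  given type in the given context; there it has to halt with the truth value.
\<close>

definition decides_judgmental_equality :: "recf \<Rightarrow> bool" where
  "decides_judgmental_equality f \<longleftrightarrow>
     has_arity f 4 \<and>
     (\<forall>\<Gamma> A M M'. \<Gamma> \<turnstile> IsTm M A \<longrightarrow> \<Gamma> \<turnstile> IsTm M' A \<longrightarrow>
        rec_eval f [code_ctx \<Gamma>, code_ty A, code_tm M, code_tm M']
          (if \<Gamma> \<turnstile> EqTm M M' A then 1 else 0))"

end

theory Submission
  imports Defs
begin

text \<open>
  In a suitable context of operations and equations on \<open>o\<close>, judgmental equality contains a rewriting
  evaluator for all partial recursive functions, by reflection of the equations. If \<open>f\<close> decided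
  equality, the function \<open>h\<close> that asks \<open>f\<close> whether \<open>h\<close>, applied to its own code, provably has value
  \<open>1\<close>, and answers the opposite, would be recursive; its computation on its own code is provable, so
  \<open>0 = 1\<close> would be derivable in the context. It is not: the terms, being unannotated, live
  in a graph model of the untyped lambda calculus, where types are interpreted as partial equivalence
  relations and \<open>o\<close> as a discrete set carrying a total evaluation function. This realizability model
  replaces the set-theoretic one, which HOL cannot form uniformly in all types.
\<close>

section \<open>A graph model of the untyped lambda calculus\<close>

text \<open>\<open>Arr as b\<close> is one step of a function graph: the output \<open>b\<close>
  appears once the input contains the finite set \<open>set as\<close>. Lists stand in for finite
  sets to keep the datatype free.\<close>

datatype 'a elem = Atom 'a | Arr "'a elem list" "'a elem"

type_synonym 'a env = "nat \<Rightarrow> 'a elem set"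

definition ap :: "'a elem set \<Rightarrow> 'a elem set \<Rightarrow> 'a elem set" where
  "ap f x = {b. \<exists>as. set as \<subseteq> x \<and> Arr as b \<in> f}"

text \<open>\<open>Refl\<close> may denote the empty set because identity types are proof irrelevant
  in the model.\<close>

primrec itm :: "tm \<Rightarrow> 'a env \<Rightarrow> 'a elem set" where
  "itm (Var i) \<rho> = \<rho> i"
| "itm (Lam t) \<rho> = {Arr as b | as b. b \<in> itm t (case_nat (set as) \<rho>)}"
| "itm (App t u) \<rho> = ap (itm t \<rho>) (itm u \<rho>)"
| "itm (Refl t) \<rho> = {}"

lemma ap_mono: "f \<subseteq> g \<Longrightarrow> x \<subseteq> y \<Longrightarrow> ap f x \<subseteq> ap g y"
  unfolding ap_def by blast

lemma ap_empty [simp]: "ap {} x = {}"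
  by (simp add: ap_def)

lemma itm_mono: "(\<And>i. \<rho> i \<subseteq> \<rho>' i) \<Longrightarrow> itm t \<rho> \<subseteq> itm t \<rho>'"
proof (induction t arbitrary: \<rho> \<rho>')
  case (Lam t)
  have "itm t (case_nat X \<rho>) \<subseteq> itm t (case_nat X \<rho>')" for X
    by (rule Lam.IH) (simp add: Lam.prems split: nat.split)
  then show ?case by auto
next
  case (App t u)
  then show ?case by (simp add: ap_mono)
qed auto

text \<open>An output consults only finitely many elements of each variable's value. For an
  application, the finite environments of the function and of each of the finitely many list members
  are joined.\<close>

lemma itm_continuous:
  "b \<in> itm t \<rho> \<Longrightarrow> \<exists>\<rho>'. (\<forall>i. finite (\<rho>' i) \<and> \<rho>' i \<subseteq> \<rho> i) \<and> b \<in> itm t \<rho>'"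
proof (induction t arbitrary: b \<rho>)
  case (Var i)
  then show ?case by (intro exI[of _ "\<lambda>j. if j = i then {b} else {}"]) auto
next
  case (Lam t)
  then obtain as c where b: "b = Arr as c" "c \<in> itm t (case_nat (set as) \<rho>)"
    by auto
  then obtain \<rho>' where r: "\<And>i. finite (\<rho>' i) \<and> \<rho>' i \<subseteq> case_nat (set as) \<rho> i" "c \<in> itm t \<rho>'"
    using Lam.IH by meson
  have "itm t \<rho>' \<subseteq> itm t (case_nat (set as) (\<lambda>i. \<rho>' (Suc i)))"
  proof (rule itm_mono)
    show "\<rho>' i \<subseteq> case_nat (set as) (\<lambda>i. \<rho>' (Suc i)) i" for i
      using r(1)[of i] by (cases i) auto
  qed
  moreover have "finite (\<rho>' (Suc i)) \<and> \<rho>' (Suc i) \<subseteq> \<rho> i" for i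
    using r(1)[of "Suc i"] by simp
  ultimately show ?case
    using r(2) b(1) by (intro exI[of _ "\<lambda>i. \<rho>' (Suc i)"]) auto
next
  case (App t u)
  then obtain as where as: "set as \<subseteq> itm u \<rho>" "Arr as b \<in> itm t \<rho>"
    by (auto simp: ap_def)
  obtain \<rho>1 where r1: "\<And>i. finite (\<rho>1 i) \<and> \<rho>1 i \<subseteq> \<rho> i" "Arr as b \<in> itm t \<rho>1"
    using App.IH(1)[OF as(2)] by blast
  have "\<forall>a\<in>set as. \<exists>\<rho>'. (\<forall>i. finite (\<rho>' i) \<and> \<rho>' i \<subseteq> \<rho> i) \<and> a \<in> itm u \<rho>'"
    using App.IH(2) as(1) by blast
  then obtain R where
    R: "\<And>a. a \<in> set as \<Longrightarrow> (\<forall>i. finite (R a i) \<and> R a i \<subseteq> \<rho> i) \<and> a \<in> itm u (R a)"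
    by metis
  define \<rho>' where "\<rho>' i = \<rho>1 i \<union> (\<Union>a\<in>set as. R a i)" for i
  have "set as \<subseteq> itm u \<rho>'"
  proof
    fix a assume a: "a \<in> set as"
    have "itm u (R a) \<subseteq> itm u \<rho>'"
      by (rule itm_mono) (use a in \<open>auto simp: \<rho>'_def\<close>)
    with R[OF a] show "a \<in> itm u \<rho>'" by blast
  qed
  moreover have "itm t \<rho>1 \<subseteq> itm t \<rho>'"
    by (rule itm_mono) (auto simp: \<rho>'_def)
  moreover have "finite (\<rho>' i) \<and> \<rho>' i \<subseteq> \<rho> i" for i
    using r1(1)[of i] R unfolding \<rho>'_def by blast
  ultimately show ?case
    using r1(2) by (intro exI[of _ \<rho>']) (auto simp: ap_def)
qed auto

text \<open>Semantic beta. One inclusion is monotonicity; for the other, continuity cuts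
  \<open>x\<close> down to a finite set, which then serves as the argument list of an
  \<open>Arr\<close>.\<close>

lemma ap_Lam: "ap (itm (Lam t) \<rho>) x = itm t (case_nat x \<rho>)"
proof (intro equalityI subsetI)
  fix b assume "b \<in> ap (itm (Lam t) \<rho>) x"
  then obtain as where as: "set as \<subseteq> x" "b \<in> itm t (case_nat (set as) \<rho>)"
    by (auto simp: ap_def)
  have "itm t (case_nat (set as) \<rho>) \<subseteq> itm t (case_nat x \<rho>)"
    by (rule itm_mono) (simp add: as(1) split: nat.split)
  with as(2) show "b \<in> itm t (case_nat x \<rho>)" by blast
next
  fix b assume "b \<in> itm t (case_nat x \<rho>)"
  then obtain \<rho>' where r: "\<And>i. finite (\<rho>' i) \<and> \<rho>' i \<subseteq> case_nat x \<rho> i" "b \<in> itm t \<rho>'"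
    using itm_continuous by meson
  from r(1)[of 0] obtain as where as: "set as = \<rho>' 0" "set as \<subseteq> x"
    using finite_list by force
  have "itm t \<rho>' \<subseteq> itm t (case_nat (set as) \<rho>)"
  proof (rule itm_mono)
    show "\<rho>' i \<subseteq> case_nat (set as) \<rho> i" for i
      using r(1)[of i] as by (cases i) auto
  qed
  with r(2) as(2) show "b \<in> ap (itm (Lam t) \<rho>) x"
    by (auto simp: ap_def)
qed

section \<open>Lifting as deletion, and substitution as insertion, of an entry of the
  environment\<close>

definition drp :: "nat \<Rightarrow> (nat \<Rightarrow> 'b) \<Rightarrow> nat \<Rightarrow> 'b" where
  "drp k \<rho> = (\<lambda>i. if i < k then \<rho> i else \<rho> (Suc i))"

definition ins :: "nat \<Rightarrow> 'b \<Rightarrow> (nat \<Rightarrow> 'b) \<Rightarrow> nat \<Rightarrow> 'b" where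
  "ins k x \<rho> = (\<lambda>i. if i < k then \<rho> i else if i = k then x else \<rho> (i - 1))"

lemma drp_case_nat: "drp (Suc k) (case_nat x \<rho>) = case_nat x (drp k \<rho>)"
  by (auto simp: drp_def fun_eq_iff split: nat.split)

lemma ins_case_nat: "ins (Suc k) y (case_nat x \<rho>) = case_nat x (ins k y \<rho>)"
  by (auto simp: ins_def fun_eq_iff split: nat.split)

lemma ins_0: "ins 0 x \<rho> = case_nat x \<rho>"
  by (auto simp: ins_def fun_eq_iff split: nat.split)

lemma drp_0: "drp 0 \<rho> = (\<lambda>i. \<rho> (Suc i))"
  by (simp add: drp_def)

lemma drp_tail: "(\<lambda>i. drp (Suc k) \<rho> (Suc i)) = drp k (\<lambda>i. \<rho> (Suc i))"
  by (simp add: drp_def)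

lemma ins_tail: "(\<lambda>i. ins (Suc k) x \<rho> (Suc i)) = ins k x (\<lambda>i. \<rho> (Suc i))"
  by (auto simp: ins_def fun_eq_iff)

lemma itm_lift: "itm (lift_tm k t) \<rho> = itm t (drp k \<rho>)"
  by (induction t arbitrary: k \<rho>) (auto simp: drp_case_nat[symmetric], auto simp: drp_def)

lemma itm_lift_iter: "itm ((lift_tm 0 ^^ k) t) \<rho> = itm t (\<lambda>i. \<rho> (i + k))"
  by (induction k arbitrary: \<rho>) (simp_all add: itm_lift drp_0)

lemma itm_subst: "itm (subst_tm k s t) \<rho> = itm t (ins k (itm s (\<lambda>i. \<rho> (i + k))) \<rho>)"
proof (induction t arbitrary: k \<rho>)
  case (Var i)
  then show ?case by (auto simp: ins_def itm_lift_iter)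
next
  case (Lam t)
  show ?case by (simp add: Lam.IH ins_case_nat)
qed auto

section \<open>The model of types as partial equivalence relations\<close>

text \<open>At \<open>TId\<close> either all sets are related or none, which validates reflection
  and uniqueness of proofs. The codomain of \<open>TPi\<close> is read at the left argument;
  \<open>wty\<close> ensures that the right one gives the same relation.\<close>

primrec ity :: "ty \<Rightarrow> 'a env \<Rightarrow> 'a elem set \<Rightarrow> 'a elem set \<Rightarrow> bool" where
  "ity TBase \<rho> x y \<longleftrightarrow> x = y \<and> (\<exists>a. x = {Atom a})"
| "ity (TPi A B) \<rho> f g \<longleftrightarrow> (\<forall>x y. ity A \<rho> x y \<longrightarrow> ity B (case_nat x \<rho>) (ap f x) (ap g y))"
| "ity (TId A t u) \<rho> x y \<longleftrightarrow> ity A \<rho> (itm t \<rho>) (itm u \<rho>)"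

text \<open>
  Invariance of \<^term>\<open>ity A\<close> under related environments, demanded hereditarily: without the recursion
  into components, \<open>id_reflect\<close> and \<open>app\<close> could not recover the validity of \<open>A\<close> or \<open>B\<close> from
  that of \<open>TId A t u\<close> or \<open>TPi A B\<close>.
\<close>

primrec wty :: "ty \<Rightarrow> 'a env \<Rightarrow> 'a env \<Rightarrow> bool" where
  "wty TBase \<rho> \<rho>' \<longleftrightarrow> True"
| "wty (TPi A B) \<rho> \<rho>' \<longleftrightarrow>
     wty A \<rho> \<rho>' \<and> (\<forall>x y. ity A \<rho> x y \<longrightarrow> wty B (case_nat x \<rho>) (case_nat y \<rho>'))"
| "wty (TId A t u) \<rho> \<rho>' \<longleftrightarrow>
     wty A \<rho> \<rho>' \<and> ity A \<rho> (itm t \<rho>) (itm t \<rho>') \<and> ity A \<rho> (itm u \<rho>) (itm u \<rho>')"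

text \<open>In the case of \<open>TPi\<close>, comparing the pairs \<open>x\<close>,
  \<open>y\<close> and \<open>y\<close>, \<open>y\<close> shows that the codomain is the same at
  related arguments (\<open>B'\<close>). Symmetry needs this; transitivity passes through
  \<open>ap g x\<close>.\<close>

lemma wty_per:
  "wty A \<rho> \<rho>' \<Longrightarrow> ity A \<rho> = ity A \<rho>' \<and> symp (ity A \<rho>) \<and> transp (ity A \<rho>)"
proof (induction A arbitrary: \<rho> \<rho>')
  case TBase
  then show ?case by (auto simp: fun_eq_iff symp_def transp_def)
next
  case (TPi A B)
  have A: "ity A \<rho> = ity A \<rho>'" "symp (ity A \<rho>)" "transp (ity A \<rho>)"
    using TPi.IH(1) TPi.prems by auto
  have B: "ity B (case_nat x \<rho>) = ity B (case_nat y \<rho>')"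
    "symp (ity B (case_nat x \<rho>))" "transp (ity B (case_nat x \<rho>))" if "ity A \<rho> x y" for x y
    using TPi.IH(2) TPi.prems that by auto
  have sym: "ity A \<rho> y x" if "ity A \<rho> x y" for x y
    using that A(2) by (auto elim: sympE)
  have rfl: "ity A \<rho> x x" if "ity A \<rho> x y" for x y
    using that sym[OF that] A(3) by (auto elim: transpE)
  have B': "ity B (case_nat x \<rho>) = ity B (case_nat y \<rho>)" if "ity A \<rho> x y" for x y
    using B(1)[OF that] B(1)[OF rfl[OF sym[OF that]]] by simp
  have B'': "ity B (case_nat x \<rho>) = ity B (case_nat x \<rho>')" if "ity A \<rho> x y" for x y
    using B(1)[OF rfl[OF that]] by simp
  have "ity (TPi A B) \<rho> = ity (TPi A B) \<rho>'"
    using A(1) B'' by (auto simp: fun_eq_iff)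
  moreover have "symp (ity (TPi A B) \<rho>)"
  proof (rule sympI)
    fix f g assume fg: "ity (TPi A B) \<rho> f g"
    have "ity B (case_nat x \<rho>) (ap g x) (ap f y)" if "ity A \<rho> x y" for x y
      using fg sym[OF that] B(2)[OF sym[OF that]] B'[OF that] by (auto elim: sympE)
    then show "ity (TPi A B) \<rho> g f" by simp
  qed
  moreover have "transp (ity (TPi A B) \<rho>)"
  proof (rule transpI)
    fix f g h assume fg: "ity (TPi A B) \<rho> f g" and gh: "ity (TPi A B) \<rho> g h"
    have "ity B (case_nat x \<rho>) (ap f x) (ap h y)" if "ity A \<rho> x y" for x y
    proof -
      have "ity B (case_nat x \<rho>) (ap f x) (ap g x)" using fg rfl[OF that] by simp
      moreover have "ity B (case_nat x \<rho>) (ap g x) (ap h y)" using gh that by simp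
      ultimately show ?thesis using B(3)[OF that] by (auto elim: transpE)
    qed
    then show "ity (TPi A B) \<rho> f h" by simp
  qed
  ultimately show ?case by blast
next
  case (TId A t u)
  then have A: "ity A \<rho> = ity A \<rho>'" "symp (ity A \<rho>)" "transp (ity A \<rho>)"
    by auto
  have "ity A \<rho> (itm t \<rho>) (itm u \<rho>) = ity A \<rho>' (itm t \<rho>') (itm u \<rho>')"
    using TId.prems A unfolding A(1)[symmetric] by (simp, meson sympE transpE)
  then show ?case by (auto simp: fun_eq_iff symp_def transp_def)
qed

lemma ity_lift: "ity (lift_ty k A) \<rho> = ity A (drp k \<rho>)"
  by (induction A arbitrary: k \<rho>) (simp_all add: fun_eq_iff itm_lift drp_case_nat)

lemma wty_lift: "wty (lift_ty k A) \<rho> \<rho>' = wty A (drp k \<rho>) (drp k \<rho>')"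
  by (induction A arbitrary: k \<rho> \<rho>') (simp_all add: ity_lift itm_lift drp_case_nat)

lemma ity_subst: "ity (subst_ty k s A) \<rho> = ity A (ins k (itm s (\<lambda>i. \<rho> (i + k))) \<rho>)"
  by (induction A arbitrary: k \<rho>) (simp_all add: fun_eq_iff itm_subst ins_case_nat)

lemma wty_subst:
  "wty (subst_ty k s A) \<rho> \<rho>' =
    wty A (ins k (itm s (\<lambda>i. \<rho> (i + k))) \<rho>) (ins k (itm s (\<lambda>i. \<rho>' (i + k))) \<rho>')"
  by (induction A arbitrary: k \<rho> \<rho>') (simp_all add: ity_subst itm_subst ins_case_nat)

lemma ity_lift_iter: "ity ((lift_ty 0 ^^ k) A) \<rho> = ity A (\<lambda>i. \<rho> (i + k))"
  by (induction k arbitrary: \<rho>) (simp_all add: ity_lift drp_0)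

lemma wty_lift_iter: "wty ((lift_ty 0 ^^ k) A) \<rho> \<rho>' = wty A (\<lambda>i. \<rho> (i + k)) (\<lambda>i. \<rho>' (i + k))"
  by (induction k arbitrary: \<rho> \<rho>') (simp_all add: wty_lift drp_0)

section \<open>Related environments and validity of judgments\<close>

primrec erel :: "ctx \<Rightarrow> 'a env \<Rightarrow> 'a env \<Rightarrow> bool" where
  "erel [] \<rho> \<rho>' \<longleftrightarrow> True"
| "erel (A # \<Gamma>) \<rho> \<rho>' \<longleftrightarrow> erel \<Gamma> (\<lambda>i. \<rho> (Suc i)) (\<lambda>i. \<rho>' (Suc i)) \<and>
     ity A (\<lambda>i. \<rho> (Suc i)) (\<rho> 0) (\<rho>' 0)"

primrec jval :: "jdg \<Rightarrow> 'a env \<Rightarrow> 'a env \<Rightarrow> bool" where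
  "jval IsCtx \<rho> \<rho>' \<longleftrightarrow> True"
| "jval (IsTy A) \<rho> \<rho>' \<longleftrightarrow> wty A \<rho> \<rho>'"
| "jval (EqTy A B) \<rho> \<rho>' \<longleftrightarrow> wty A \<rho> \<rho>' \<and> wty B \<rho> \<rho>' \<and> ity A \<rho> = ity B \<rho>'"
| "jval (IsTm a A) \<rho> \<rho>' \<longleftrightarrow> wty A \<rho> \<rho>' \<and> ity A \<rho> (itm a \<rho>) (itm a \<rho>')"
| "jval (EqTm a b A) \<rho> \<rho>' \<longleftrightarrow> wty A \<rho> \<rho>' \<and> ity A \<rho> (itm a \<rho>) (itm b \<rho>')"

primrec vctx :: "'a itself \<Rightarrow> ctx \<Rightarrow> bool" where
  "vctx T [] \<longleftrightarrow> True"
| "vctx T (A # \<Gamma>) \<longleftrightarrow> vctx T \<Gamma> \<and> (\<forall>(\<rho>::'a env) \<rho>'. erel \<Gamma> \<rho> \<rho>' \<longrightarrow> wty A \<rho> \<rho>')"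

text \<open>\<open>T\<close> fixes the type of atoms, which the syntax does not mention. Validity of
  the context is included so that every induction hypothesis of \<open>soundness\<close> makes
  \<open>erel\<close> symmetric and transitive.\<close>

definition valid :: "'a itself \<Rightarrow> ctx \<Rightarrow> jdg \<Rightarrow> bool" where
  "valid T \<Gamma> J \<longleftrightarrow> vctx T \<Gamma> \<and> (\<forall>(\<rho>::'a env) \<rho>'. erel \<Gamma> \<rho> \<rho>' \<longrightarrow> jval J \<rho> \<rho>')"

lemma jval_lift: "jval (lift_jd k J) \<rho> \<rho>' = jval J (drp k \<rho>) (drp k \<rho>')"
  by (cases J) (simp_all add: ity_lift itm_lift wty_lift)

lemma jval_subst:
  "jval (subst_jd k s J) \<rho> \<rho>' =
    jval J (ins k (itm s (\<lambda>i. \<rho> (i + k))) \<rho>) (ins k (itm s (\<lambda>i. \<rho>' (i + k))) \<rho>')"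
  by (cases J) (simp_all add: ity_subst itm_subst wty_subst)

lemma erel_sym:
  fixes \<rho> :: "'a env"
  shows "vctx TYPE('a) \<Gamma> \<Longrightarrow> erel \<Gamma> \<rho> \<rho>' \<Longrightarrow> erel \<Gamma> \<rho>' \<rho>"
proof (induction \<Gamma> arbitrary: \<rho> \<rho>')
  case (Cons A \<Gamma>)
  then have "wty A (\<lambda>i. \<rho> (Suc i)) (\<lambda>i. \<rho>' (Suc i))" by simp
  from wty_per[OF this] show ?case using Cons by (auto elim: sympE)
qed simp

lemma erel_trans:
  fixes \<rho> :: "'a env"
  shows "vctx TYPE('a) \<Gamma> \<Longrightarrow> erel \<Gamma> \<rho> \<rho>' \<Longrightarrow> erel \<Gamma> \<rho>' \<rho>'' \<Longrightarrow> erel \<Gamma> \<rho> \<rho>''"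
proof (induction \<Gamma> arbitrary: \<rho> \<rho>' \<rho>'')
  case (Cons A \<Gamma>)
  then have "wty A (\<lambda>i. \<rho> (Suc i)) (\<lambda>i. \<rho>' (Suc i))" by simp
  from wty_per[OF this] show ?case using Cons by (auto elim: transpE)
qed simp

lemma erel_refl:
  fixes \<rho> :: "'a env"
  assumes "vctx TYPE('a) \<Gamma>" "erel \<Gamma> \<rho> \<rho>'"
  shows "erel \<Gamma> \<rho> \<rho>" "erel \<Gamma> \<rho>' \<rho>'"
  using assms erel_sym erel_trans by blast+

lemma vctx_append: "vctx T (\<Delta> @ \<Gamma>) \<Longrightarrow> vctx T \<Gamma>"
  by (induction \<Delta>) auto

lemma erel_append: "erel (\<Delta> @ \<Gamma>) \<rho> \<rho>' \<Longrightarrow> erel \<Gamma> (\<lambda>i. \<rho> (i + length \<Delta>)) (\<lambda>i. \<rho>' (i + length \<Delta>))"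
  by (induction \<Delta> arbitrary: \<rho> \<rho>') fastforce+

lemma length_tel [simp]: "length (lift_tel \<Delta>) = length \<Delta>" "length (subst_tel s \<Delta>) = length \<Delta>"
  by (induction \<Delta>) auto

lemma erel_lift:
  "erel (lift_tel \<Delta> @ A # \<Gamma>) \<rho> \<rho>' \<Longrightarrow> erel (\<Delta> @ \<Gamma>) (drp (length \<Delta>) \<rho>) (drp (length \<Delta>) \<rho>')"
proof (induction \<Delta> arbitrary: \<rho> \<rho>')
  case Nil
  then show ?case by (simp add: drp_0)
next
  case (Cons D \<Delta>)
  then show ?case by (simp add: drp_tail ity_lift) (simp add: drp_def)
qed

lemma vctx_lift:
  assumes "\<forall>(\<rho>::'a env) \<rho>'. erel \<Gamma> \<rho> \<rho>' \<longrightarrow> wty A \<rho> \<rho>'"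
  shows "vctx TYPE('a) (\<Delta> @ \<Gamma>) \<Longrightarrow> vctx TYPE('a) (lift_tel \<Delta> @ A # \<Gamma>)"
  using assms by (induction \<Delta>) (auto simp: wty_lift dest: erel_lift)

text \<open>Allowing \<open>a'\<close> on the right serves the congruence rules as well as
  substitution. The telescope is instantiated with \<open>a\<close> because the left environment
  determines the relation at each of its types.\<close>

lemma erel_subst:
  fixes \<rho> :: "'a env"
  assumes "\<And>(\<rho>::'a env) \<rho>'. erel \<Gamma> \<rho> \<rho>' \<Longrightarrow> ity A \<rho> (itm a \<rho>) (itm a' \<rho>')"
  shows "erel (subst_tel a \<Delta> @ \<Gamma>) \<rho> \<rho>' \<Longrightarrow>
    erel (\<Delta> @ A # \<Gamma>) (ins (length \<Delta>) (itm a (\<lambda>i. \<rho> (i + length \<Delta>))) \<rho>)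
      (ins (length \<Delta>) (itm a' (\<lambda>i. \<rho>' (i + length \<Delta>))) \<rho>')"
proof (induction \<Delta> arbitrary: \<rho> \<rho>')
  case Nil
  then show ?case by (simp add: ins_0 assms)
next
  case (Cons D \<Delta>)
  have "erel (\<Delta> @ A # \<Gamma>) (ins (length \<Delta>) (itm a (\<lambda>i. \<rho> (Suc (i + length \<Delta>)))) (\<lambda>i. \<rho> (Suc i)))
      (ins (length \<Delta>) (itm a' (\<lambda>i. \<rho>' (Suc (i + length \<Delta>)))) (\<lambda>i. \<rho>' (Suc i)))"
    using Cons.IH[of "\<lambda>i. \<rho> (Suc i)" "\<lambda>i. \<rho>' (Suc i)"] Cons.prems by simp
  then show ?case
    using Cons.prems by (simp add: ins_tail ity_subst) (simp add: ins_def)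
qed

lemma vctx_subst:
  assumes "\<And>(\<rho>::'a env) \<rho>'. erel \<Gamma> \<rho> \<rho>' \<Longrightarrow> ity A \<rho> (itm a \<rho>) (itm a \<rho>')"
  shows "vctx TYPE('a) (\<Delta> @ A # \<Gamma>) \<Longrightarrow> vctx TYPE('a) (subst_tel a \<Delta> @ \<Gamma>)"
proof (induction \<Delta>)
  case (Cons D \<Delta>)
  then show ?case using erel_subst[OF assms, of \<Gamma> \<Delta>] by (simp add: wty_subst)
qed simp

text \<open>\<open>jval\<close> records only the crossed relation, of \<open>a\<close> under
  \<open>\<rho>\<close> to \<open>b\<close> under \<open>\<rho>'\<close>. Reading it at all four
  pairs of the two environments and applying \<open>wty_per\<close> recovers the rest, including the
  typing of both sides.\<close>

lemma valid_eq_tmD: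
  fixes \<rho> :: "'a env"
  assumes "valid TYPE('a) \<Gamma> (EqTm a b A)" "erel \<Gamma> \<rho> \<rho>'"
  shows "wty A \<rho> \<rho>'" "ity A \<rho> (itm a \<rho>) (itm a \<rho>')" "ity A \<rho> (itm b \<rho>) (itm b \<rho>')"
    "ity A \<rho> (itm a \<rho>) (itm b \<rho>')" "ity A \<rho> (itm b \<rho>) (itm a \<rho>')"
    "ity A \<rho> (itm a \<rho>) (itm b \<rho>)"
proof -
  have v: "vctx TYPE('a) \<Gamma>" using assms(1) by (simp add: valid_def)
  note r = erel_refl[OF v assms(2)] erel_sym[OF v assms(2)]
  have 1: "wty A \<rho> \<rho>'" "ity A \<rho> (itm a \<rho>) (itm b \<rho>')" "ity A \<rho> (itm a \<rho>) (itm b \<rho>)"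
    "ity A \<rho>' (itm a \<rho>') (itm b \<rho>')" "ity A \<rho>' (itm a \<rho>') (itm b \<rho>)"
    using assms r by (auto simp: valid_def)
  note P = wty_per[OF 1(1)]
  have eq: "ity A \<rho>' = ity A \<rho>" and sym: "\<And>x y. ity A \<rho> x y \<Longrightarrow> ity A \<rho> y x"
    and trans: "\<And>x y z. ity A \<rho> x y \<Longrightarrow> ity A \<rho> y z \<Longrightarrow> ity A \<rho> x z"
    using P by (auto elim: sympE transpE)
  show "wty A \<rho> \<rho>'" "ity A \<rho> (itm a \<rho>) (itm b \<rho>')" "ity A \<rho> (itm a \<rho>) (itm b \<rho>)"
    using 1 by auto
  show "ity A \<rho> (itm a \<rho>) (itm a \<rho>')" "ity A \<rho> (itm b \<rho>) (itm b \<rho>')" "ity A \<rho> (itm b \<rho>) (itm a \<rho>')"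
    using 1 eq sym trans by metis+
qed

lemma valid_is_tmD:
  fixes \<rho> :: "'a env"
  assumes "valid TYPE('a) \<Gamma> (IsTm a A)" "erel \<Gamma> \<rho> \<rho>'"
  shows "wty A \<rho> \<rho>'" "ity A \<rho> (itm a \<rho>) (itm a \<rho>')"
  using assms by (auto simp: valid_def)

lemma valid_vctx: "valid T \<Gamma> J \<Longrightarrow> vctx T \<Gamma>"
  by (simp add: valid_def)

lemma valid_eq_tyD:
  fixes \<rho> :: "'a env"
  assumes "valid TYPE('a) \<Gamma> (EqTy A B)" "erel \<Gamma> \<rho> \<rho>'"
  shows "wty A \<rho> \<rho>'" "wty B \<rho> \<rho>'" "ity A \<rho> = ity B \<rho>" "ity A \<rho> = ity A \<rho>'" "ity A \<rho> = ity B \<rho>'"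
proof -
  show 1: "wty A \<rho> \<rho>'" "wty B \<rho> \<rho>'" "ity A \<rho> = ity B \<rho>'" using assms by (auto simp: valid_def)
  show "ity A \<rho> = ity B \<rho>" "ity A \<rho> = ity A \<rho>'"
    using wty_per[OF 1(1)] wty_per[OF 1(2)] 1(3) by auto
qed

theorem soundness: "\<Gamma> \<turnstile> J \<Longrightarrow> valid TYPE('a) \<Gamma> J"
proof (induction rule: derivable.induct)
  case ctx_empty
  then show ?case by (simp add: valid_def)
next
  case (ctx_ext \<Gamma> A)
  then show ?case by (simp add: valid_def)
next
  case (var \<Gamma> i)
  have v: "vctx TYPE('a) \<Gamma>" by (rule valid_vctx[OF var.IH])
  have *: "\<Gamma> = take i \<Gamma> @ \<Gamma> ! i # drop (Suc i) \<Gamma>" using var.hyps(2) by (rule id_take_nth_drop)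
  have "vctx TYPE('a) (\<Gamma> ! i # drop (Suc i) \<Gamma>)"
    by (rule vctx_append[of _ "take i \<Gamma>"]) (use v * in simp)
  \<comment> \<open>The type of variable \<open>i\<close> lives in the context below it, so the
    first \<open>i\<close> entries of both environments are dropped.\<close>
  moreover have "erel (\<Gamma> ! i # drop (Suc i) \<Gamma>) (\<lambda>j. \<rho> (j + i)) (\<lambda>j. \<rho>' (j + i))"
    if "erel \<Gamma> \<rho> \<rho>'" for \<rho> \<rho>' :: "'a env"
    using erel_append[of "take i \<Gamma>" "\<Gamma> ! i # drop (Suc i) \<Gamma>" \<rho> \<rho>'] that * var.hyps(2) by simp
  ultimately show ?case
    using v unfolding valid_def jval.simps ity_lift_iter wty_lift_iter by fastforce
next
  case (weaken \<Delta> \<Gamma> J A)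
  then show ?case
    using vctx_lift[of \<Gamma> A \<Delta>] by (auto simp: valid_def jval_lift dest: erel_lift)
next
  case (subst \<Delta> A \<Gamma> J a)
  then have "ity A \<rho> (itm a \<rho>) (itm a \<rho>')" if "erel \<Gamma> \<rho> \<rho>'" for \<rho> \<rho>' :: "'a env"
    using that by (simp add: valid_def)
  note s = erel_subst[OF this] vctx_subst[OF this]
  from subst show ?case
    by (auto simp: valid_def jval_subst intro: s)
next
  case (subst_ty_cong \<Delta> A \<Gamma> B a a')
  note D = valid_eq_tmD[OF subst_ty_cong.IH(4)]
  have s: "erel (\<Delta> @ A # \<Gamma>) (ins (length \<Delta>) (itm a (\<lambda>i. \<rho> (i + length \<Delta>))) \<rho>)
      (ins (length \<Delta>) (itm c (\<lambda>i. \<rho>' (i + length \<Delta>))) \<rho>')"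
    if "erel (subst_tel a \<Delta> @ \<Gamma>) \<rho> \<rho>'" "c = a \<or> c = a'" for \<rho> \<rho>' :: "'a env" and c
    by (rule erel_subst[OF _ that(1)]) (use D that(2) in blast)
  note v = valid_vctx[OF subst_ty_cong.IH(1)]
  have w: "vctx TYPE('a) (subst_tel a \<Delta> @ \<Gamma>)"
    by (rule vctx_subst[OF D(2) v])
  have B: "wty B \<rho> \<rho>'" if "erel (\<Delta> @ A # \<Gamma>) \<rho> \<rho>'" for \<rho> \<rho>' :: "'a env"
    using subst_ty_cong.IH(1) that by (simp add: valid_def)
  \<comment> \<open>\<open>erel_subst\<close> does not give this directly, as the telescope is
    instantiated with \<open>a\<close>; the environment with \<open>a\<close> inserted over
    \<open>\<rho>\<close> serves as intermediate point.\<close>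
  have r: "erel (\<Delta> @ A # \<Gamma>) (ins (length \<Delta>) (itm a' (\<lambda>i. \<rho> (i + length \<Delta>))) \<rho>)
      (ins (length \<Delta>) (itm a' (\<lambda>i. \<rho>' (i + length \<Delta>))) \<rho>')"
    if "erel (subst_tel a \<Delta> @ \<Gamma>) \<rho> \<rho>'" for \<rho> \<rho>' :: "'a env"
    using erel_trans[OF v erel_sym[OF v s[OF erel_refl(1)[OF w that]]] s[OF that]]
    by simp
  show ?case
    using w B[OF s] B[OF r] wty_per[OF B[OF s]]
    by (simp add: valid_def wty_subst ity_subst)
next
  case (subst_tm_cong \<Delta> A \<Gamma> b B a a')
  note D = valid_eq_tmD[OF subst_tm_cong.IH(4)]
  note s = erel_subst[OF D(2)] erel_subst[OF D(4)] vctx_subst[OF D(2)]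
  note B = valid_is_tmD[OF subst_tm_cong.IH(1)]
  show ?case
    using s(3)[OF _ valid_vctx[OF subst_tm_cong.IH(1)]] B[OF s(1)] B[OF s(2)]
    by (simp add: valid_def wty_subst ity_subst itm_subst)
next
  case (ty_refl \<Gamma> A)
  then show ?case by (auto simp: valid_def dest: wty_per)
next
  case (ty_sym \<Gamma> A B)
  note D = valid_eq_tyD[OF ty_sym.IH]
  show ?case
    using valid_vctx[OF ty_sym.IH] D by (simp add: valid_def)
next
  case (ty_trans \<Gamma> A B C)
  note D = valid_eq_tyD[OF ty_trans.IH(1)] valid_eq_tyD[OF ty_trans.IH(2)]
  show ?case
    using valid_vctx[OF ty_trans.IH(1)] D by (simp add: valid_def)
next
  case (tm_refl \<Gamma> a A)
  then show ?case by (simp add: valid_def)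
next
  case (tm_sym \<Gamma> a b A)
  show ?case
    using valid_vctx[OF tm_sym.IH] valid_eq_tmD[OF tm_sym.IH] by (simp add: valid_def)
next
  case (tm_trans \<Gamma> a b A c)
  note D = valid_eq_tmD[OF tm_trans.IH(1)] valid_eq_tmD[OF tm_trans.IH(2)]
  have "ity A \<rho> (itm a \<rho>) (itm c \<rho>')" if r: "erel \<Gamma> \<rho> \<rho>'" for \<rho> \<rho>' :: "'a env"
    using D(6)[OF r] D(10)[OF r] wty_per[OF D(1)[OF r]] by (auto elim: transpE)
  then show ?case
    using valid_vctx[OF tm_trans.IH(1)] D(1) by (simp add: valid_def)
next
  case (conv_tm \<Gamma> a A B)
  note D = valid_eq_tyD[OF conv_tm.IH(2)]
  show ?case
    using conv_tm.IH(1) D by (simp add: valid_def)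
next
  case (conv_eq \<Gamma> a b A B)
  note D = valid_eq_tyD[OF conv_eq.IH(2)]
  show ?case
    using conv_eq.IH(1) D by (simp add: valid_def)
next
  case (base_form \<Gamma>)
  then show ?case by (simp add: valid_def)
next
  case (pi_form \<Gamma> A B)
  then show ?case by (simp add: valid_def)
next
  case (pi_form_cong \<Gamma> A A' B B')
  note D = valid_eq_tyD[OF pi_form_cong.IH(1)]
  note E = valid_eq_tyD[OF pi_form_cong.IH(2)]
  have e: "erel (A # \<Gamma>) (case_nat x \<rho>) (case_nat y \<rho>')" if "erel \<Gamma> \<rho> \<rho>'" "ity A \<rho> x y"
    for \<rho> \<rho>' :: "'a env" and x y using that by simp
  have q: "ity (TPi A B) \<rho> f g = ity (TPi A' B') \<rho>' f g" if r: "erel \<Gamma> \<rho> \<rho>'" for \<rho> \<rho>' :: "'a env" and f g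
  proof -
    have "ity B (case_nat x \<rho>) = ity B' (case_nat x \<rho>')" if xy: "ity A \<rho> x y" for x y
    proof -
      \<comment> \<open>The codomains are compared at the same argument \<open>x\<close> under both
        environments, so \<open>x\<close> must be related to itself.\<close>
      have "ity A \<rho> x x"
        using xy wty_per[OF D(1)[OF r]] by (meson sympE transpE)
      from E(5)[OF e[OF r this]] show ?thesis .
    qed
    then show ?thesis using D(5)[OF r] by auto
  qed
  show ?case
    unfolding valid_def
  proof (intro conjI allI impI)
    show "vctx TYPE('a) \<Gamma>" by (rule valid_vctx[OF pi_form_cong.IH(1)])
    fix \<rho> \<rho>' :: "'a env" assume r: "erel \<Gamma> \<rho> \<rho>'"
    show "jval (EqTy (TPi A B) (TPi A' B')) \<rho> \<rho>'"
      using D[OF r] E(1,2)[OF e[OF r]] q[OF r] by (simp add: fun_eq_iff)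
  qed
next
  case (lam A \<Gamma> b B)
  note E = valid_is_tmD[OF lam.IH]
  from valid_vctx[OF lam.IH] show ?case
    using E by (auto simp: valid_def ap_Lam simp del: itm.simps(2))
next
  case (lam_cong A \<Gamma> b b' B)
  note E = valid_eq_tmD[OF lam_cong.IH]
  from valid_vctx[OF lam_cong.IH] show ?case
    using E(1,4) by (auto simp: valid_def ap_Lam simp del: itm.simps(2))
next
  case (app \<Gamma> c A B a)
  then show ?case by (simp add: valid_def ity_subst wty_subst ins_0)
next
  case (app_cong \<Gamma> c c' A B a a')
  note D = valid_eq_tmD[OF app_cong.IH(1)] valid_eq_tmD[OF app_cong.IH(2)]
  from valid_vctx[OF app_cong.IH(1)] show ?case 
    using D(1,4) D(8,10) by (simp add: valid_def ity_subst wty_subst ins_0)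
next
  case (beta A \<Gamma> b B a)
  note E = valid_is_tmD[OF beta.IH(1)] and D = valid_is_tmD[OF beta.IH(2)]
  from valid_vctx[OF beta.IH(2)] show ?case 
    using E D by (simp add: valid_def ity_subst wty_subst itm_subst ins_0 ap_Lam del: itm.simps(2))
next
  \<comment> \<open>As sets the two sides may differ, but the relation at \<open>TPi\<close> looks
    only at applications, and these agree by \<open>ap_Lam\<close>.\<close>
  case (eta \<Gamma> c A B)
  then show ?case
    by (simp add: valid_def ap_Lam itm_lift drp_0 del: itm.simps(2))
next
  case (id_form \<Gamma> a A a')
  then show ?case by (simp add: valid_def)
next
  case (id_form_cong \<Gamma> A B a b a' b')
  note D = valid_eq_tyD[OF id_form_cong.IH(1)]
  note E = valid_eq_tmD[OF id_form_cong.IH(2)] valid_eq_tmD[OF id_form_cong.IH(3)]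
  have q: "ity (TId A a a') \<rho> x y = ity (TId B b b') \<rho>' x y" if r: "erel \<Gamma> \<rho> \<rho>'" for \<rho> \<rho>' :: "'a env" and x y
    using E[OF r] D[OF r] wty_per[OF D(1)[OF r]] by simp (metis sympE transpE)
  show ?case
    unfolding valid_def
  proof (intro conjI allI impI)
    show "vctx TYPE('a) \<Gamma>" by (rule valid_vctx[OF id_form_cong.IH(1)])
    fix \<rho> \<rho>' :: "'a env" assume r: "erel \<Gamma> \<rho> \<rho>'"
    show "jval (EqTy (TId A a a') (TId B b b')) \<rho> \<rho>'"
      using D[OF r] E[OF r] q[OF r] by (simp add: fun_eq_iff)
  qed
next
  case (id_intro \<Gamma> a A)
  note D = valid_is_tmD[OF id_intro.IH]
  have "ity A \<rho> (itm a \<rho>) (itm a \<rho>)" if r: "erel \<Gamma> \<rho> \<rho>'" for \<rho> \<rho>' :: "'a env"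
    using D(2)[OF erel_refl(1)[OF valid_vctx[OF id_intro.IH] r]] .
  with id_intro.IH show ?case by (simp add: valid_def)
next
  case (id_intro_cong \<Gamma> a b A)
  note D = valid_eq_tmD[OF id_intro_cong.IH]
  note v = valid_vctx[OF id_intro_cong.IH]
  have "ity A \<rho> (itm a \<rho>) (itm a \<rho>)" if r: "erel \<Gamma> \<rho> \<rho>'" for \<rho> \<rho>' :: "'a env"
    using D(2)[OF erel_refl(1)[OF v r]] .
  with D v show ?case by (simp add: valid_def)
next
  case (id_reflect \<Gamma> c A a a')
  show ?case
    unfolding valid_def
  proof (intro conjI allI impI)
    show "vctx TYPE('a) \<Gamma>" by (rule valid_vctx[OF id_reflect.IH])
    fix \<rho> \<rho>' :: "'a env" assume r: "erel \<Gamma> \<rho> \<rho>'"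
    have w: "wty A \<rho> \<rho>'" "ity A \<rho> (itm a \<rho>) (itm a' \<rho>)" "ity A \<rho> (itm a' \<rho>) (itm a' \<rho>')"
      using valid_is_tmD[OF id_reflect.IH r] by auto
    then show "jval (EqTm a a' A) \<rho> \<rho>'"
      using wty_per[OF w(1)] by (auto elim: transpE)
  qed
next
  case (id_unique \<Gamma> c A a a')
  then show ?case by (simp add: valid_def)
qed

section \<open>Equational theories as contexts\<close>

text \<open>
  The binary operation \<open>0\<close> is to be interpreted as an evaluator, the other ones as free constructors.
\<close>

datatype fo = V nat | K | B nat fo fo

datatype tree = Leaf | Nd nat tree tree

abbreviation (input) oo :: ty where
  "oo \<equiv> TPi TBase (TPi TBase TBase)"

abbreviation pi4 :: "ty \<Rightarrow> ty" where
  "pi4 T \<equiv> TPi TBase (TPi TBase (TPi TBase (TPi TBase T)))"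

text \<open>
  \<open>d\<close> is the index of operation \<open>0\<close> in the context; the operations \<open>0, \<dots>, 9\<close> and the constant are
  declared consecutively from there on.
\<close>

primrec emb :: "nat \<Rightarrow> (nat \<Rightarrow> tm) \<Rightarrow> fo \<Rightarrow> tm" where
  "emb d \<theta> (V j) = \<theta> j"
| "emb d \<theta> K = Var (d + 10)"
| "emb d \<theta> (B i a b) = App (App (Var (d + i)) (emb d \<theta> a)) (emb d \<theta> b)"

primrec wf_fo :: "fo \<Rightarrow> bool" where
  "wf_fo (V j) \<longleftrightarrow> j < 4"
| "wf_fo K \<longleftrightarrow> True"
| "wf_fo (B i a b) \<longleftrightarrow> i < 10 \<and> wf_fo a \<and> wf_fo b"

text \<open>Every equation quantifies over all four variables, so that one instantiation lemma fits
  all. \<open>V j\<close> becomes the index \<open>j\<close>, and the operations move up by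
  4.\<close>

definition eqty :: "nat \<Rightarrow> fo \<Rightarrow> fo \<Rightarrow> ty" where
  "eqty d l r = pi4 (TId TBase (emb (4 + d) Var l) (emb (4 + d) Var r))"

primrec eqctx :: "(fo \<times> fo) list \<Rightarrow> ctx" where
  "eqctx [] = replicate 10 oo @ [TBase]"
| "eqctx (e # R) = eqty (length R) (fst e) (snd e) # eqctx R"

lemma length_eqctx [simp]: "length (eqctx R) = length R + 11"
  by (induction R) simp_all

lemma emb_cong: "wf_fo t \<Longrightarrow> (\<And>j. j < 4 \<Longrightarrow> \<theta> j = \<theta>' j) \<Longrightarrow> emb d \<theta> t = emb d \<theta>' t"
  by (induction t) auto

lemma lift_emb: "c \<le> d \<Longrightarrow> lift_tm c (emb d \<theta> t) = emb (Suc d) (\<lambda>j. lift_tm c (\<theta> j)) t"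
  by (induction t) auto

lemma subst_emb: "k \<le> d \<Longrightarrow> subst_tm k s (emb (Suc d) \<theta> t) = emb d (\<lambda>j. subst_tm k s (\<theta> j)) t"
  by (induction t) auto

lemma lift_eqty: "wf_fo l \<Longrightarrow> wf_fo r \<Longrightarrow> lift_ty 0 (eqty d l r) = eqty (Suc d) l r"
  by (simp add: eqty_def lift_emb) (auto intro!: emb_cong)

lemma lift_eqty_iter:
  "wf_fo l \<Longrightarrow> wf_fo r \<Longrightarrow> (lift_ty 0 ^^ k) (eqty d l r) = eqty (d + k) l r"
  by (induction k) (simp_all add: lift_eqty)

lemma lift_oo_iter: "(lift_ty 0 ^^ k) oo = oo" "(lift_ty 0 ^^ k) TBase = TBase"
  by (induction k) simp_all

lemma subst_lift: "subst_tm k s (lift_tm k t) = t"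
  by (induction t arbitrary: k) auto

lemma lift_lift: "i \<le> c \<Longrightarrow> lift_tm (Suc c) (lift_tm i t) = lift_tm i (lift_tm c t)"
  by (induction t arbitrary: i c) auto

lemma lift_lift_iter: "lift_tm k ((lift_tm 0 ^^ k) t) = (lift_tm 0 ^^ Suc k) t"
  by (induction k) (simp_all add: lift_lift)

lemma subst_lift_iter: "subst_tm k s ((lift_tm 0 ^^ Suc k) t) = (lift_tm 0 ^^ k) t"
  unfolding lift_lift_iter[symmetric] by (rule subst_lift)

lemma var_closed:
  assumes "\<Gamma> \<turnstile> IsCtx" "i < length \<Gamma>" "\<Gamma> ! i = T" "T = oo \<or> T = TBase"
  shows "\<Gamma> \<turnstile> IsTm (Var i) T"
proof -
  have "(lift_ty 0 ^^ Suc i) (\<Gamma> ! i) = T"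
    using assms(3,4) lift_oo_iter by metis
  then show ?thesis
    using derivable.var[OF assms(1,2)] by simp
qed

lemma emb_typed:
  assumes "\<And>i. i < 10 \<Longrightarrow> \<Gamma> \<turnstile> IsTm (Var (d + i)) oo" "\<Gamma> \<turnstile> IsTm (Var (d + 10)) TBase"
    and "\<And>j. j < 4 \<Longrightarrow> \<Gamma> \<turnstile> IsTm (\<theta> j) TBase"
  shows "wf_fo t \<Longrightarrow> \<Gamma> \<turnstile> IsTm (emb d \<theta> t) TBase"
proof (induction t)
  case (B i a b)
  have "\<Gamma> \<turnstile> IsTm (App (Var (d + i)) (emb d \<theta> a)) (TPi TBase TBase)"
    using derivable.app[of \<Gamma> "Var (d + i)" TBase "TPi TBase TBase" "emb d \<theta> a"] assms(1) B by simp
  then show ?case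
    using derivable.app[of \<Gamma> _ TBase TBase "emb d \<theta> b"] B by simp
qed (use assms in auto)

lemma eqctx_nth: "length R + j < length (eqctx R) \<Longrightarrow> eqctx R ! (length R + j) = (if j < 10 then oo else TBase)"
  by (induction R) (auto simp: nth_append)

lemma eqctx_nth_eq:
  "i < length R \<Longrightarrow> eqctx R ! i = eqty (length R - Suc i) (fst (R ! i)) (snd (R ! i))"
  by (induction R arbitrary: i) (auto simp: nth_Cons split: nat.split)

lemma base_ext: "\<Gamma> \<turnstile> IsCtx \<Longrightarrow> TBase # \<Gamma> \<turnstile> IsCtx"
  by (intro derivable.intros)

lemma ops_ctx: "replicate n oo @ [TBase] \<turnstile> IsCtx"
  by (induction n) (auto intro!: derivable.intros)

lemma eqctx_ctx: "(\<And>l r. (l, r) \<in> set R \<Longrightarrow> wf_fo l \<and> wf_fo r) \<Longrightarrow> eqctx R \<turnstile> IsCtx"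
proof (induction R)
  case Nil
  show ?case unfolding eqctx.simps by (rule ops_ctx)
next
  case (Cons e R)
  let ?\<Delta> = "TBase # TBase # TBase # TBase # eqctx R"
  have c: "eqctx R \<turnstile> IsCtx" using Cons by auto
  then have d: "?\<Delta> \<turnstile> IsCtx" by (intro base_ext)
  have T: "?\<Delta> \<turnstile> IsTm (emb (4 + length R) Var t) TBase" if "wf_fo t" for t
  proof (rule emb_typed[OF _ _ _ that])
    fix i :: nat assume "i < 10"
    then show "?\<Delta> \<turnstile> IsTm (Var (4 + length R + i)) oo"
      using eqctx_nth[of R i] by (intro var_closed[OF d]) auto
  next
    show "?\<Delta> \<turnstile> IsTm (Var (4 + length R + 10)) TBase"
      using eqctx_nth[of R 10] by (intro var_closed[OF d]) (auto simp: nth_Cons' add.commute)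
  next
    fix j :: nat assume "j < 4"
    then show "?\<Delta> \<turnstile> IsTm (Var j) TBase"
      by (intro var_closed[OF d]) (auto simp: nth_Cons')
  qed
  have "wf_fo (fst e)" "wf_fo (snd e)" using Cons.prems[of "fst e" "snd e"] by auto
  then show ?case
    unfolding eqctx.simps eqty_def
    by (intro derivable.ctx_ext derivable.pi_form derivable.base_form derivable.id_form T base_ext c)
qed

text \<open>The variable witnessing the equation is applied to four terms, and the resulting
  identity proof is reflected. \<open>\<theta> 3\<close> comes first because \<open>V 3\<close> is
  bound outermost.\<close>

lemma eqctx_instance:
  assumes R: "\<And>l r. (l, r) \<in> set R \<Longrightarrow> wf_fo l \<and> wf_fo r" and lr: "(l, r) \<in> set R"
    and a: "\<And>j. j < 4 \<Longrightarrow> eqctx R \<turnstile> IsTm (\<theta> j) TBase"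
  shows "eqctx R \<turnstile> EqTm (emb (length R) \<theta> l) (emb (length R) \<theta> r) TBase"
proof -
  let ?\<Gamma> = "eqctx R" and ?l = "emb (4 + length R) Var l" and ?r = "emb (4 + length R) Var r"
  have w: "wf_fo l" "wf_fo r" using R lr by auto
  obtain i where i: "i < length R" "R ! i = (l, r)"
    using lr by (meson in_set_conv_nth)
  have "?\<Gamma> \<turnstile> IsTm (Var i) ((lift_ty 0 ^^ Suc i) (?\<Gamma> ! i))"
    using i by (intro derivable.var eqctx_ctx R) auto
  \<comment> \<open>Equation \<open>i\<close> was formed over a tail of the context with
    \<open>length R - Suc i\<close> equations; lifting \<open>Suc i\<close> times moves it to the
    whole context.\<close>
  moreover have "length R - Suc i + Suc i = length R" using i(1) by simp
  then have "(lift_ty 0 ^^ Suc i) (?\<Gamma> ! i) = eqty (length R) l r"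
    unfolding eqctx_nth_eq[OF i(1)] i(2) fst_conv snd_conv lift_eqty_iter[OF w] by (simp only:)
  ultimately have "?\<Gamma> \<turnstile> IsTm (Var i) (pi4 (TId TBase ?l ?r))"
    by (simp add: eqty_def)
  from derivable.app[OF derivable.app[OF derivable.app[OF derivable.app[OF this a[of 3],
      simplified] a[of 2], simplified] a[of 1], simplified] a[of 0], simplified]
  have "?\<Gamma> \<turnstile> IsTm (App (App (App (App (Var i) (\<theta> 3)) (\<theta> 2)) (\<theta> 1)) (\<theta> 0))
    (TId TBase
      (subst_tm 0 (\<theta> 0) (subst_tm 1 (\<theta> 1) (subst_tm 2 (\<theta> 2) (subst_tm 3 (\<theta> 3) ?l))))
      (subst_tm 0 (\<theta> 0) (subst_tm 1 (\<theta> 1) (subst_tm 2 (\<theta> 2) (subst_tm 3 (\<theta> 3) ?r)))))"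
    by (simp add: numeral_eq_Suc)
  then have e: "?\<Gamma> \<turnstile> EqTm
      (subst_tm 0 (\<theta> 0) (subst_tm 1 (\<theta> 1) (subst_tm 2 (\<theta> 2) (subst_tm 3 (\<theta> 3) ?l))))
      (subst_tm 0 (\<theta> 0) (subst_tm 1 (\<theta> 1) (subst_tm 2 (\<theta> 2) (subst_tm 3 (\<theta> 3) ?r)))) TBase"
    by (rule derivable.id_reflect)
  \<comment> \<open>Arguments put in early are lifted over the binders still open; each later
    substitution removes one of these lifts.\<close>
  have L: "subst_tm k s ((lift_tm 0 ^^ n) t) = (lift_tm 0 ^^ k) t" if "n = Suc k" for k n s t
    unfolding that by (rule subst_lift_iter)
  have M: "subst_tm k s (emb d \<theta>' t) = emb (d - 1) (\<lambda>j. subst_tm k s (\<theta>' j)) t"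
    if "k < d" for k d s t \<theta>'
    using that subst_emb[of k "d - 1"] by simp
  have "subst_tm 0 (\<theta> 0) (subst_tm 1 (\<theta> 1) (subst_tm 2 (\<theta> 2) (subst_tm 3 (\<theta> 3)
      (emb (4 + length R) Var t)))) = emb (length R) \<theta> t" if "wf_fo t" for t
  proof -
    have "subst_tm 0 (\<theta> 0) (subst_tm 1 (\<theta> 1) (subst_tm 2 (\<theta> 2) (subst_tm 3 (\<theta> 3) (Var j)))) = \<theta> j"
      if "j < 4" for j
    proof -
      from that consider "j = 0" | "j = 1" | "j = 2" | "j = 3" by linarith
      then show ?thesis by cases (simp_all add: L subst_lift)
    qed
    then show ?thesis
      using that by (simp add: M del: subst_tm.simps) (rule emb_cong)
  qed
  with e w show ?thesis by simp
qed

section \<open>Interpreting the equation contexts by an algebra on the atoms\<close>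

definition fun2 :: "('a \<Rightarrow> 'a \<Rightarrow> 'a) \<Rightarrow> 'a elem set" where
  "fun2 \<phi> = {Arr [Atom a] (Arr [Atom b] (Atom (\<phi> a b))) | a b. True}"

text \<open>Singleton argument lists suffice in \<open>fun2\<close>, since the elements of
  \<open>o\<close> are singletons of atoms.\<close>

lemma ap_fun2: "ap (ap (fun2 \<phi>) {Atom a}) {Atom b} = {Atom (\<phi> a b)}"
proof -
  have "ap (fun2 \<phi>) {Atom a} = {Arr [Atom b] (Atom (\<phi> a b)) | b. True}"
    by (force simp: ap_def fun2_def)
  then show ?thesis
    by (force simp: ap_def)
qed

primrec fo_eval :: "(nat \<Rightarrow> 'a \<Rightarrow> 'a \<Rightarrow> 'a) \<Rightarrow> 'a \<Rightarrow> (nat \<Rightarrow> 'a) \<Rightarrow> fo \<Rightarrow> 'a" where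
  "fo_eval \<phi> c \<nu> (V j) = \<nu> j"
| "fo_eval \<phi> c \<nu> K = c"
| "fo_eval \<phi> c \<nu> (B i a b) = \<phi> i (fo_eval \<phi> c \<nu> a) (fo_eval \<phi> c \<nu> b)"

lemma itm_emb:
  assumes "\<And>i. i < 10 \<Longrightarrow> \<rho> (d + i) = fun2 (\<phi> i)" "\<rho> (d + 10) = {Atom c}"
    and "\<And>j. j < 4 \<Longrightarrow> itm (\<theta> j) \<rho> = {Atom (\<nu> j)}"
  shows "wf_fo t \<Longrightarrow> itm (emb d \<theta> t) \<rho> = {Atom (fo_eval \<phi> c \<nu> t)}"
  by (induction t) (auto simp: assms ap_fun2)

text \<open>The witnesses of the equations are interpreted by the empty set, as \<^term>\<open>ap {} x = {}\<close>.\<close>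

definition theory_env :: "(nat \<Rightarrow> 'a \<Rightarrow> 'a \<Rightarrow> 'a) \<Rightarrow> 'a \<Rightarrow> nat \<Rightarrow> 'a env" where
  "theory_env \<phi> c n =
    (\<lambda>i. if i < n then {} else if i < n + 10 then fun2 (\<phi> (i - n)) else {Atom c})"

lemma erel_ops:
  assumes "\<rho> n = {Atom c}" "\<And>i. i < n \<Longrightarrow> \<exists>\<psi>. \<rho> i = fun2 \<psi>"
  shows "erel (replicate n oo @ [TBase]) \<rho> \<rho>"
  using assms
proof (induction n arbitrary: \<rho>)
  case (Suc n)
  then obtain \<psi> where "\<rho> 0 = fun2 \<psi>" by blast
  then show ?case using Suc.IH[of "\<lambda>i. \<rho> (Suc i)"] Suc.prems by (auto simp: ap_fun2)
qed simp

text \<open>An algebra satisfying the equations inhabits the context: once both sides of an equation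
  agree, \<open>TId\<close> relates any two sets, in particular the empty ones.\<close>

lemma erel_eqctx:
  assumes "\<And>l r. (l, r) \<in> set R \<Longrightarrow> wf_fo l \<and> wf_fo r"
    and "\<And>l r \<nu>. (l, r) \<in> set R \<Longrightarrow> fo_eval \<phi> c \<nu> l = fo_eval \<phi> c \<nu> r"
  shows "erel (eqctx R) (theory_env \<phi> c (length R)) (theory_env \<phi> c (length R))"
  using assms
proof (induction R)
  case Nil
  have "erel (replicate 10 oo @ [TBase]) (theory_env \<phi> c 0) (theory_env \<phi> c 0)"
    by (rule erel_ops) (auto simp: theory_env_def)
  then show ?case by simp
next
  case (Cons e R)
  let ?\<rho> = "theory_env \<phi> c (length R)"
  obtain l r where e: "e = (l, r)" by (cases e)
  have w: "wf_fo l" "wf_fo r" using Cons.prems(1) e by auto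
  have 1: "(\<lambda>i. theory_env \<phi> c (length (e # R)) (Suc i)) = ?\<rho>"
    "theory_env \<phi> c (length (e # R)) 0 = {}"
    by (auto simp: theory_env_def fun_eq_iff)
  have v: "itm (emb (4 + length R) Var t)
      (case_nat {Atom a0} (case_nat {Atom a1} (case_nat {Atom a2} (case_nat {Atom a3} ?\<rho>)))) =
      {Atom (fo_eval \<phi> c (\<lambda>j. [a0, a1, a2, a3] ! j) t)}" if "wf_fo t" for t a0 a1 a2 a3
  proof (rule itm_emb[OF _ _ _ that])
    fix j :: nat assume "j < 4"
    then consider "j = 0" | "j = 1" | "j = 2" | "j = 3" by linarith
    then show "itm (Var j)
      (case_nat {Atom a0} (case_nat {Atom a1} (case_nat {Atom a2} (case_nat {Atom a3} ?\<rho>)))) =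
      {Atom ([a0, a1, a2, a3] ! j)}"
      by cases (simp_all add: numeral_eq_Suc)
  qed (simp_all add: theory_env_def numeral_eq_Suc)
  have "ity (eqty (length R) l r) ?\<rho> {} {}"
    using v[OF w(1)] v[OF w(2)] Cons.prems(2)[of l r] e by (auto simp: eqty_def)
  moreover have "erel (eqctx R) ?\<rho> ?\<rho>" using Cons by auto
  ultimately show ?case using 1 e by simp
qed

section \<open>An equational theory of evaluation\<close>

text \<open>
  Operation \<open>1\<close> is list cons, and doubles as the successor in the form \<open>B 1 K n\<close>. Codes of functions
  are built from \<open>K\<close> (zero) and the operations \<open>2\<close> (successor), \<open>3\<close> (projection), \<open>4\<close> (composition),
  \<open>5\<close> (primitive recursion), \<open>6\<close> (minimization), \<open>7\<close> (cons of the values of two codes), \<open>8\<close>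
  (search upwards from the first argument) and \<open>9\<close> (a search step whose test value is already known).
  The payload of \<open>2\<close>, \<open>3\<close>, \<open>6\<close>, \<open>8\<close> and \<open>9\<close> is padded by \<open>K\<close>.
\<close>

definition rules :: "(fo \<times> fo) list" where
  "rules = (let ev = B 0; f = V 0; g = V 1; n = V 2; x = V 3; cons = B 1; sc = B 1 K in
   [(ev K x, K),
    (ev (B 2 K K) (cons n x), sc n),
    (ev (B 3 K K) (cons n x), n),
    (ev (B 3 (sc f) K) (cons n x), ev (B 3 f K) x),
    (ev (B 4 f g) x, ev f (ev g x)),
    (ev (B 7 f g) x, cons (ev f x) (ev g x)),
    (ev (B 5 f g) (cons K x), ev f x),
    (ev (B 5 f g) (cons (sc n) x), ev g (cons n (cons (ev (B 5 f g) (cons n x)) x))),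
    (ev (B 6 f K) x, ev (B 8 f K) (cons K x)),
    (ev (B 8 f K) (cons n x), ev (B 9 f K) (cons (ev f (cons n x)) (cons n x))),
    (ev (B 9 f K) (cons K (cons n x)), n),
    (ev (B 9 f K) (cons (sc g) (cons n x)), ev (B 8 f K) (cons (sc n) x))])"

lemma length_rules [simp]: "length rules = 12"
  by (simp add: rules_def Let_def)

lemma wf_rules: "(l, r) \<in> set rules \<Longrightarrow> wf_fo l \<and> wf_fo r"
  by (auto simp: rules_def Let_def)

section \<open>A total algebra of trees satisfying the rules\<close>

primrec hd_tree :: "tree \<Rightarrow> tree" where
  "hd_tree Leaf = Leaf"
| "hd_tree (Nd i a b) = a"

primrec tl_tree :: "tree \<Rightarrow> tree" where
  "tl_tree Leaf = Leaf"
| "tl_tree (Nd i a b) = b"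

text \<open>Any tree counts as a number, namely the length of its right spine; this makes projection
  and primitive recursion total on trees.\<close>

primrec proj_tree :: "tree \<Rightarrow> tree \<Rightarrow> tree" where
  "proj_tree Leaf x = hd_tree x"
| "proj_tree (Nd i a b) x = proj_tree b (tl_tree x)"

primrec rec_tree :: "(tree \<Rightarrow> tree) \<Rightarrow> (tree \<Rightarrow> tree) \<Rightarrow> tree \<Rightarrow> tree \<Rightarrow> tree" where
  "rec_tree F G Leaf x = F x"
| "rec_tree F G (Nd i a n) x = G (Nd 1 n (Nd 1 (rec_tree F G n x) x))"

text \<open>
  An unsuccessful search has the value \<^term>\<open>Leaf\<close>: the equations determine nothing there, so the
  model can consist of total functions.
\<close>

definition search_tree :: "(tree \<Rightarrow> tree) \<Rightarrow> tree \<Rightarrow> tree \<Rightarrow> tree" where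
  "search_tree F n x = (if \<exists>k. F (Nd 1 ((Nd 1 Leaf ^^ k) n) x) = Leaf
    then (Nd 1 Leaf ^^ (LEAST k. F (Nd 1 ((Nd 1 Leaf ^^ k) n) x) = Leaf)) n else Leaf)"

text \<open>This is the content of the rules for operations \<open>8\<close> and \<open>9\<close>
  together. If the first test fails, starting one step later lowers the least successful index by
  one, or both searches fail.\<close>

lemma search_tree_unfold:
  "search_tree F n x = (if F (Nd 1 n x) = Leaf then n else search_tree F (Nd 1 Leaf n) x)"
proof -
  define N where "N k = (Nd 1 Leaf ^^ k) n" for k
  define P where "P k \<longleftrightarrow> F (Nd 1 (N k) x) = Leaf" for k
  have N: "(Nd 1 Leaf ^^ k) (Nd 1 Leaf n) = N (Suc k)" for k
    unfolding N_def by (induction k) simp_all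
  have N0: "N 0 = n" by (simp add: N_def)
  have 0: "search_tree F n x = (if \<exists>k. P k then N (LEAST k. P k) else Leaf)"
    unfolding search_tree_def P_def N_def ..
  have 1: "search_tree F (Nd 1 Leaf n) x =
      (if \<exists>k. P (Suc k) then N (Suc (LEAST k. P (Suc k))) else Leaf)"
    unfolding search_tree_def N P_def ..
  show ?thesis
  proof (cases "P 0")
    case True
    then have "(LEAST k. P k) = 0" by (rule Least_eq_0)
    with True have "search_tree F n x = n" unfolding 0 using N0 by auto
    with True show ?thesis by (simp add: P_def N0)
  next
    case False
    have "(\<exists>k. P k) \<longleftrightarrow> (\<exists>k. P (Suc k))" using False by (metis not0_implies_Suc)
    moreover have "(LEAST k. P k) = Suc (LEAST k. P (Suc k))" if "\<exists>k. P k"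
      using that False Least_Suc by blast
    ultimately have "search_tree F n x = search_tree F (Nd 1 Leaf n) x"
      unfolding 0 1 by auto
    with False show ?thesis by (simp add: P_def N0)
  qed
qed

text \<open>Structural recursion on the code suffices because looping on data is delegated to
  \<open>rec_tree\<close> and \<open>search_tree\<close>, which receive the subcodes as functions.
  The last two branches are the search step of label \<open>9\<close>; all remaining labels fall
  there too.\<close>

primrec ev_tree :: "tree \<Rightarrow> tree \<Rightarrow> tree" where
  "ev_tree Leaf x = Leaf"
| "ev_tree (Nd i f g) x =
    (if i = 2 then Nd 1 Leaf (hd_tree x)
     else if i = 3 then proj_tree f x
     else if i = 4 then ev_tree f (ev_tree g x)
     else if i = 7 then Nd 1 (ev_tree f x) (ev_tree g x)
     else if i = 5 then rec_tree (ev_tree f) (ev_tree g) (hd_tree x) (tl_tree x)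
     else if i = 6 then search_tree (ev_tree f) Leaf x
     else if i = 8 then search_tree (ev_tree f) (hd_tree x) (tl_tree x)
     else if hd_tree x = Leaf then hd_tree (tl_tree x)
     else search_tree (ev_tree f) (Nd 1 Leaf (hd_tree (tl_tree x))) (tl_tree (tl_tree x)))"

definition op_tree :: "nat \<Rightarrow> tree \<Rightarrow> tree \<Rightarrow> tree" where
  "op_tree i = (if i = 0 then ev_tree else Nd i)"

lemma rules_sound:
  "(l, r) \<in> set rules \<Longrightarrow> fo_eval op_tree Leaf \<nu> l = fo_eval op_tree Leaf \<nu> r"
  \<comment> \<open>Only the search starting at \<open>V 2\<close> is unfolded, since the general
    equation would rewrite forever.\<close>
  by (auto simp: rules_def Let_def op_tree_def search_tree_unfold[of _ "\<nu> 2"])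

section \<open>Provable equality in the context of the rules\<close>

definition ev_ctx :: ctx where
  "ev_ctx = eqctx rules"

text \<open>The 12 equations occupy the indices below 12, the ten operations 12 to 21, and the
  constant 22.\<close>

definition nil_tm :: tm where
  "nil_tm = Var 22"

definition op_tm :: "nat \<Rightarrow> tm \<Rightarrow> tm \<Rightarrow> tm" where
  "op_tm i a b = App (App (Var (12 + i)) a) b"

primrec num_tm :: "nat \<Rightarrow> tm" where
  "num_tm 0 = nil_tm"
| "num_tm (Suc n) = op_tm 1 nil_tm (num_tm n)"

lemma ev_ctx_ctx: "ev_ctx \<turnstile> IsCtx"
  unfolding ev_ctx_def by (rule eqctx_ctx) (rule wf_rules)

lemma ev_ctx_op: "i < 10 \<Longrightarrow> ev_ctx \<turnstile> IsTm (Var (12 + i)) oo"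
  using eqctx_nth[of rules i] by (intro var_closed[OF ev_ctx_ctx]) (auto simp: ev_ctx_def)

lemma nil_typed: "ev_ctx \<turnstile> IsTm nil_tm TBase"
  using eqctx_nth[of rules 10] unfolding nil_tm_def
  by (intro var_closed[OF ev_ctx_ctx]) (auto simp: ev_ctx_def)

lemma op_typed:
  assumes "i < 10" "ev_ctx \<turnstile> IsTm a TBase" "ev_ctx \<turnstile> IsTm b TBase"
  shows "ev_ctx \<turnstile> IsTm (op_tm i a b) TBase"
  using derivable.app[OF derivable.app[OF ev_ctx_op[OF assms(1)] assms(2), simplified] assms(3)]
  by (simp add: op_tm_def)

lemma num_typed: "ev_ctx \<turnstile> IsTm (num_tm n) TBase"
  by (induction n) (simp_all add: nil_typed op_typed)

definition deq :: "tm \<Rightarrow> tm \<Rightarrow> bool" (infix "\<approx>" 50) where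
  "s \<approx> t \<longleftrightarrow> ev_ctx \<turnstile> EqTm s t TBase"

lemma deq_trans [trans]: "s \<approx> t \<Longrightarrow> t \<approx> u \<Longrightarrow> s \<approx> u"
  unfolding deq_def by (rule derivable.tm_trans)

lemma deq_refl: "ev_ctx \<turnstile> IsTm s TBase \<Longrightarrow> s \<approx> s"
  unfolding deq_def by (rule derivable.tm_refl)

lemma op_cong:
  assumes "i < 10" "a \<approx> a'" "b \<approx> b'"
  shows "op_tm i a b \<approx> op_tm i a' b'"
  using derivable.app_cong[OF derivable.app_cong[OF derivable.tm_refl[OF ev_ctx_op[OF assms(1)]]
    assms(2)[unfolded deq_def], simplified] assms(3)[unfolded deq_def]]
  by (simp add: op_tm_def deq_def)

text \<open>By soundness, in the tree algebra the numerals denote the distinct atoms for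
  \<open>Leaf\<close> and \<open>Nd 1 Leaf Leaf\<close>.\<close>

lemma num_consistent: "\<not> num_tm 0 \<approx> num_tm (Suc 0)"
proof
  let ?\<rho> = "theory_env op_tree Leaf 12"
  assume "num_tm 0 \<approx> num_tm (Suc 0)"
  then have "valid TYPE(tree) ev_ctx (EqTm (num_tm 0) (num_tm (Suc 0)) TBase)"
    unfolding deq_def by (rule soundness)
  moreover have "erel ev_ctx ?\<rho> ?\<rho>"
    using erel_eqctx[of rules op_tree Leaf] wf_rules rules_sound unfolding ev_ctx_def by auto
  ultimately have "itm (num_tm 0) ?\<rho> = itm (num_tm (Suc 0)) ?\<rho>"
    by (simp add: valid_def)
  moreover have "itm (op_tm 1 nil_tm nil_tm) ?\<rho> = {Atom (op_tree 1 Leaf Leaf)}"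
    by (simp add: op_tm_def nil_tm_def theory_env_def ap_fun2)
  ultimately show False
    by (simp add: nil_tm_def theory_env_def op_tree_def)
qed

lemma rule_instance:
  "(l, r) \<in> set rules \<Longrightarrow> (\<And>j. j < 4 \<Longrightarrow> ev_ctx \<turnstile> IsTm (\<theta> j) TBase) \<Longrightarrow> emb 12 \<theta> l \<approx> emb 12 \<theta> r"
  using eqctx_instance[of rules l r \<theta>] wf_rules unfolding ev_ctx_def deq_def length_rules by blast

context
  fixes f g n x :: tm
  assumes typed: "ev_ctx \<turnstile> IsTm f TBase" "ev_ctx \<turnstile> IsTm g TBase"
    "ev_ctx \<turnstile> IsTm n TBase" "ev_ctx \<turnstile> IsTm x TBase"
begin

lemma rule_instances:
  "list_all (\<lambda>(l, r). emb 12 (\<lambda>j. [f, g, n, x] ! j) l \<approx> emb 12 (\<lambda>j. [f, g, n, x] ! j) r) rules"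
proof -
  have "ev_ctx \<turnstile> IsTm ([f, g, n, x] ! j) TBase" if "j < 4" for j
  proof -
    from that consider "j = 0" | "j = 1" | "j = 2" | "j = 3" by linarith
    then show ?thesis by cases (simp_all add: typed)
  qed
  then show ?thesis
    using rule_instance by (auto simp: list_all_iff)
qed

lemma ev_equations:
  "op_tm 0 nil_tm x \<approx> nil_tm"
  "op_tm 0 (op_tm 2 nil_tm nil_tm) (op_tm 1 n x) \<approx> op_tm 1 nil_tm n"
  "op_tm 0 (op_tm 3 nil_tm nil_tm) (op_tm 1 n x) \<approx> n"
  "op_tm 0 (op_tm 3 (op_tm 1 nil_tm f) nil_tm) (op_tm 1 n x) \<approx> op_tm 0 (op_tm 3 f nil_tm) x"
  "op_tm 0 (op_tm 4 f g) x \<approx> op_tm 0 f (op_tm 0 g x)"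
  "op_tm 0 (op_tm 7 f g) x \<approx> op_tm 1 (op_tm 0 f x) (op_tm 0 g x)"
  "op_tm 0 (op_tm 5 f g) (op_tm 1 nil_tm x) \<approx> op_tm 0 f x"
  "op_tm 0 (op_tm 5 f g) (op_tm 1 (op_tm 1 nil_tm n) x) \<approx>
    op_tm 0 g (op_tm 1 n (op_tm 1 (op_tm 0 (op_tm 5 f g) (op_tm 1 n x)) x))"
  "op_tm 0 (op_tm 6 f nil_tm) x \<approx> op_tm 0 (op_tm 8 f nil_tm) (op_tm 1 nil_tm x)"
  "op_tm 0 (op_tm 8 f nil_tm) (op_tm 1 n x) \<approx>
    op_tm 0 (op_tm 9 f nil_tm) (op_tm 1 (op_tm 0 f (op_tm 1 n x)) (op_tm 1 n x))"
  "op_tm 0 (op_tm 9 f nil_tm) (op_tm 1 nil_tm (op_tm 1 n x)) \<approx> n"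
  "op_tm 0 (op_tm 9 f nil_tm) (op_tm 1 (op_tm 1 nil_tm g) (op_tm 1 n x)) \<approx>
    op_tm 0 (op_tm 8 f nil_tm) (op_tm 1 (op_tm 1 nil_tm n) x)"
  using rule_instances by (simp_all add: rules_def Let_def op_tm_def nil_tm_def)

end

section \<open>Halting computations as provable equations\<close>

primrec code_rec :: "recf \<Rightarrow> tm" where
  "code_rec Zero = nil_tm"
| "code_rec Succ = op_tm 2 nil_tm nil_tm"
| "code_rec (Proj i) = op_tm 3 (num_tm i) nil_tm"
| "code_rec (Comp f gs) = op_tm 4 (code_rec f) (foldr (op_tm 7) (map code_rec gs) nil_tm)"
| "code_rec (PrimRec f g) = op_tm 5 (code_rec f) (code_rec g)"
| "code_rec (Mu f) = op_tm 6 (code_rec f) nil_tm"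

definition list_tm :: "nat list \<Rightarrow> tm" where
  "list_tm xs = foldr (op_tm 1) (map num_tm xs) nil_tm"

lemma list_tm_simps [simp]:
  "list_tm [] = nil_tm" "list_tm (x # xs) = op_tm 1 (num_tm x) (list_tm xs)"
  by (simp_all add: list_tm_def)

lemma foldr_op_typed:
  "i < 10 \<Longrightarrow> (\<And>t. t \<in> set ts \<Longrightarrow> ev_ctx \<turnstile> IsTm t TBase) \<Longrightarrow>
    ev_ctx \<turnstile> IsTm (foldr (op_tm i) ts nil_tm) TBase"
  by (induction ts) (simp_all add: nil_typed op_typed)

lemma list_typed: "ev_ctx \<turnstile> IsTm (list_tm xs) TBase"
  unfolding list_tm_def by (rule foldr_op_typed) (auto simp: num_typed)

lemma code_rec_typed: "ev_ctx \<turnstile> IsTm (code_rec f) TBase"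
  by (induction f) (auto simp: nil_typed num_typed intro!: op_typed foldr_op_typed)

lemmas typed_intros = nil_typed num_typed list_typed code_rec_typed op_typed

lemma op_cong1: "i < 10 \<Longrightarrow> ev_ctx \<turnstile> IsTm b TBase \<Longrightarrow> a \<approx> a' \<Longrightarrow> op_tm i a b \<approx> op_tm i a' b"
  by (intro op_cong deq_refl)

lemma op_cong2: "i < 10 \<Longrightarrow> ev_ctx \<turnstile> IsTm a TBase \<Longrightarrow> b \<approx> b' \<Longrightarrow> op_tm i a b \<approx> op_tm i a b'"
  by (intro op_cong deq_refl)

lemma eval_proj:
  "i < length xs \<Longrightarrow> op_tm 0 (op_tm 3 (num_tm i) nil_tm) (list_tm xs) \<approx> num_tm (xs ! i)"
proof (induction i arbitrary: xs)
  case 0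
  then obtain x ys where "xs = x # ys" by (cases xs) auto
  then show ?case
    using ev_equations(3)[OF nil_typed nil_typed num_typed list_typed] by simp
next
  case (Suc i)
  then obtain x ys where xs: "xs = x # ys" by (cases xs) auto
  have "op_tm 0 (op_tm 3 (num_tm (Suc i)) nil_tm) (list_tm xs) \<approx>
      op_tm 0 (op_tm 3 (num_tm i) nil_tm) (list_tm ys)"
    unfolding xs list_tm_simps num_tm.simps
    by (rule ev_equations(4)[where g = nil_tm]) (intro typed_intros)+
  also have "\<dots> \<approx> num_tm (xs ! Suc i)"
    using Suc.IH[of ys] Suc.prems xs by simp
  finally show ?case .
qed

text \<open>A list of codes is itself a code, built by operation \<open>7\<close>, that evaluates to
  the list of values. \<open>nil_tm\<close> can end it because it evaluates to itself; the same rule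
  lets it code \<open>Zero\<close>.\<close>

lemma eval_list:
  "list_all2 (\<lambda>g y. op_tm 0 (code_rec g) (list_tm xs) \<approx> num_tm y) gs ys \<Longrightarrow>
    op_tm 0 (foldr (op_tm 7) (map code_rec gs) nil_tm) (list_tm xs) \<approx> list_tm ys"
proof (induction rule: list_all2_induct)
  case Nil
  show ?case by (auto intro!: ev_equations typed_intros)
next
  case (Cons g gs y ys)
  have t: "ev_ctx \<turnstile> IsTm (foldr (op_tm 7) (map code_rec gs) nil_tm) TBase"
    by (rule foldr_op_typed) (auto simp: code_rec_typed)
  have "op_tm 0 (op_tm 7 (code_rec g) (foldr (op_tm 7) (map code_rec gs) nil_tm)) (list_tm xs) \<approx>
    op_tm 1 (op_tm 0 (code_rec g) (list_tm xs))
      (op_tm 0 (foldr (op_tm 7) (map code_rec gs) nil_tm) (list_tm xs))"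
    by (rule ev_equations(6)[where n = nil_tm]) (intro t typed_intros)+
  also have "\<dots> \<approx> op_tm 1 (num_tm y) (list_tm ys)"
    by (intro op_cong Cons) simp
  finally show ?case by simp
qed

text \<open>The induction runs downwards from the solution \<open>n\<close>: a search starting at a
  failing \<open>m\<close> is provably equal to the one starting at \<open>Suc m\<close>.\<close>

lemma eval_search:
  assumes 0: "op_tm 0 (code_rec f) (list_tm (n # xs)) \<approx> num_tm 0"
    and S: "\<And>m. m < n \<Longrightarrow> \<exists>y. op_tm 0 (code_rec f) (list_tm (m # xs)) \<approx> num_tm (Suc y)"
    and "k \<le> n"
  shows "op_tm 0 (op_tm 8 (code_rec f) nil_tm) (list_tm (k # xs)) \<approx> num_tm n"
  using \<open>k \<le> n\<close>
proof (induction k rule: inc_induct)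
  case base
  have "op_tm 0 (op_tm 8 (code_rec f) nil_tm) (list_tm (n # xs)) \<approx>
      op_tm 0 (op_tm 9 (code_rec f) nil_tm)
        (op_tm 1 (op_tm 0 (code_rec f) (list_tm (n # xs))) (list_tm (n # xs)))"
    unfolding list_tm_simps by (rule ev_equations(10)[where g = nil_tm]) (intro typed_intros)+
  also have "\<dots> \<approx> op_tm 0 (op_tm 9 (code_rec f) nil_tm) (op_tm 1 nil_tm (list_tm (n # xs)))"
    using 0 by (intro op_cong2 op_cong1) (auto intro!: typed_intros)
  also have "\<dots> \<approx> num_tm n"
    unfolding list_tm_simps by (rule ev_equations(11)[where g = nil_tm]) (intro typed_intros)+
  finally show ?case .
next
  case (step m)
  from S[OF step.hyps(2)] obtain y where
    y: "op_tm 0 (code_rec f) (list_tm (m # xs)) \<approx> num_tm (Suc y)" by blast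
  have "op_tm 0 (op_tm 8 (code_rec f) nil_tm) (list_tm (m # xs)) \<approx>
      op_tm 0 (op_tm 9 (code_rec f) nil_tm)
        (op_tm 1 (op_tm 0 (code_rec f) (list_tm (m # xs))) (list_tm (m # xs)))"
    unfolding list_tm_simps by (rule ev_equations(10)[where g = nil_tm]) (intro typed_intros)+
  also have "\<dots> \<approx> op_tm 0 (op_tm 9 (code_rec f) nil_tm) (op_tm 1 (num_tm (Suc y)) (list_tm (m # xs)))"
    using y by (intro op_cong2 op_cong1) (auto intro!: typed_intros)
  also have "\<dots> \<approx> op_tm 0 (op_tm 8 (code_rec f) nil_tm) (list_tm (Suc m # xs))"
    unfolding list_tm_simps num_tm.simps by (rule ev_equations(12)) (intro typed_intros)+
  also have "\<dots> \<approx> num_tm n" by (rule step.IH)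
  finally show ?case .
qed

text \<open>The derivation of \<open>rec_eval\<close> is replayed clause by clause as a chain of
  rule instances.\<close>

theorem eval_complete:
  "rec_eval f xs y \<Longrightarrow> op_tm 0 (code_rec f) (list_tm xs) \<approx> num_tm y"
proof (induction rule: rec_eval.induct)
  case (rec_eval_Zero xs)
  show ?case by (auto intro!: ev_equations typed_intros)
next
  case (rec_eval_Succ x)
  show ?case
    using ev_equations(2)[OF nil_typed nil_typed num_typed nil_typed] by simp
next
  case (rec_eval_Proj i xs)
  then show ?case by (simp add: eval_proj)
next
  case (rec_eval_Comp xs gs ys f z)
  let ?gs = "foldr (op_tm 7) (map code_rec gs) nil_tm"
  have t: "ev_ctx \<turnstile> IsTm ?gs TBase"
    by (rule foldr_op_typed) (auto simp: code_rec_typed)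
  have "op_tm 0 (op_tm 4 (code_rec f) ?gs) (list_tm xs) \<approx>
      op_tm 0 (code_rec f) (op_tm 0 ?gs (list_tm xs))"
    by (rule ev_equations(5)[where n = nil_tm]) (intro t typed_intros)+
  also have "\<dots> \<approx> op_tm 0 (code_rec f) (list_tm ys)"
    by (intro op_cong2 eval_list typed_intros list_all2_mono[OF rec_eval_Comp.IH(1)]) auto
  also have "\<dots> \<approx> num_tm z" by (rule rec_eval_Comp.IH)
  finally show ?case by simp
next
  case (rec_eval_PrimRec_0 f xs y g)
  have "op_tm 0 (code_rec (PrimRec f g)) (list_tm (0 # xs)) \<approx> op_tm 0 (code_rec f) (list_tm xs)"
    unfolding list_tm_simps num_tm.simps code_rec.simps
    by (rule ev_equations(7)[where n = nil_tm]) (intro typed_intros)+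
  also note rec_eval_PrimRec_0.IH
  finally show ?case .
next
  case (rec_eval_PrimRec_Suc f g n xs y z)
  have "op_tm 0 (code_rec (PrimRec f g)) (list_tm (Suc n # xs)) \<approx>
      op_tm 0 (code_rec g) (op_tm 1 (num_tm n)
        (op_tm 1 (op_tm 0 (code_rec (PrimRec f g)) (list_tm (n # xs))) (list_tm xs)))"
    unfolding list_tm_simps num_tm.simps code_rec.simps
    by (rule ev_equations(8)) (intro typed_intros)+
  also have "\<dots> \<approx> op_tm 0 (code_rec g) (list_tm (n # y # xs))"
    unfolding list_tm_simps(2)[of n "y # xs"] list_tm_simps(2)[of y xs]
    by (intro op_cong2 op_cong1 rec_eval_PrimRec_Suc.IH) (auto intro!: typed_intros)
  also note rec_eval_PrimRec_Suc.IH(2)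
  finally show ?case .
next
  case (rec_eval_Mu f n xs)
  have "op_tm 0 (code_rec (Mu f)) (list_tm xs) \<approx>
      op_tm 0 (op_tm 8 (code_rec f) nil_tm) (list_tm (0 # xs))"
    unfolding list_tm_simps num_tm.simps code_rec.simps
    by (rule ev_equations(9)[where n = nil_tm and g = nil_tm]) (intro typed_intros)+
  also have "\<dots> \<approx> num_tm n"
    using rec_eval_Mu.IH by (intro eval_search) auto
  finally show ?case .
qed

section \<open>Computing on codes, and the diagonal function\<close>

primrec const_rec :: "nat \<Rightarrow> recf" where
  "const_rec 0 = Zero"
| "const_rec (Suc n) = Comp Succ [const_rec n]"

lemma rec_eval_Comp1: "rec_eval g xs a \<Longrightarrow> rec_eval f [a] z \<Longrightarrow> rec_eval (Comp f [g]) xs z"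
  by (rule rec_eval_Comp[of xs _ "[a]"]) simp_all

lemma rec_eval_Comp2:
  "rec_eval g xs a \<Longrightarrow> rec_eval h xs b \<Longrightarrow> rec_eval f [a, b] z \<Longrightarrow> rec_eval (Comp f [g, h]) xs z"
  by (rule rec_eval_Comp[of xs _ "[a, b]"]) simp_all

lemma const_rec: "rec_eval (const_rec n) xs n"
  by (induction n) (auto intro: rec_eval.intros(1,2) rec_eval_Comp1)

lemma rec_eval_Proj': "i < length xs \<Longrightarrow> xs ! i = y \<Longrightarrow> rec_eval (Proj i) xs y"
  using rec_eval_Proj by blast

definition add_rec :: recf where
  "add_rec = PrimRec (Proj 0) (Comp Succ [Proj 1])"

definition triangle_rec :: recf where
  "triangle_rec = PrimRec Zero (Comp add_rec [Proj 1, Comp Succ [Proj 0]])"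

text \<open>This follows the Cantor pairing \<open>triangle (m + n) + m\<close> behind
  \<open>prod_encode\<close>.\<close>

definition pair_rec :: "recf \<Rightarrow> recf \<Rightarrow> recf" where
  "pair_rec f g = Comp (Comp add_rec [Comp triangle_rec [add_rec], Proj 0]) [f, g]"

lemma add_rec: "rec_eval add_rec [m, n] (m + n)"
proof (induction m)
  case 0
  show ?case unfolding add_rec_def by (intro rec_eval_PrimRec_0 rec_eval_Proj') simp_all
next
  case (Suc m)
  have "rec_eval (Comp Succ [Proj 1]) [m, m + n, n] (Suc (m + n))"
    by (intro rec_eval_Comp1[OF _ rec_eval_Succ] rec_eval_Proj') simp_all
  with Suc show ?case
    unfolding add_rec_def add_Suc by (rule rec_eval_PrimRec_Suc)
qed

lemma triangle_rec: "rec_eval triangle_rec [n] (triangle n)"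
proof (induction n)
  case 0
  show ?case by (simp add: triangle_rec_def rec_eval_PrimRec_0 rec_eval_Zero)
next
  case (Suc n)
  have "rec_eval (Comp add_rec [Proj 1, Comp Succ [Proj 0]]) [n, triangle n] (triangle n + Suc n)"
    by (intro rec_eval_Comp2[OF _ _ add_rec] rec_eval_Comp1[OF _ rec_eval_Succ] rec_eval_Proj') simp_all
  with Suc show ?case
    unfolding triangle_rec_def triangle_Suc by (rule rec_eval_PrimRec_Suc)
qed

lemma pair_rec:
  assumes "rec_eval f xs a" "rec_eval g xs b"
  shows "rec_eval (pair_rec f g) xs (prod_encode (a, b))"
  unfolding pair_rec_def prod_encode_def prod.case
  by (intro rec_eval_Comp2[OF assms] rec_eval_Comp2[OF _ _ add_rec] rec_eval_Comp1[OF add_rec]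
      triangle_rec rec_eval_Proj') simp_all

text \<open>The computation of \<open>op_tm\<close> on codes; the constant 2 is the tag of
  \<open>App\<close> in \<open>code_tm\<close>.\<close>

definition op_rec :: "nat \<Rightarrow> recf \<Rightarrow> recf \<Rightarrow> recf" where
  "op_rec i f g = pair_rec (const_rec 2) (pair_rec
    (pair_rec (const_rec 2) (pair_rec (const_rec (code_tm (Var (12 + i)))) f)) g)"

lemma op_rec:
  "rec_eval f xs (code_tm s) \<Longrightarrow> rec_eval g xs (code_tm t) \<Longrightarrow>
    rec_eval (op_rec i f g) xs (code_tm (op_tm i s t))"
  unfolding op_rec_def op_tm_def code_tm.simps(3) by (intro pair_rec const_rec)

text \<open>Quotation: it lets the diagonal function form the code of a term that mentions its own
  input as a numeral.\<close>

definition num_rec :: recf where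
  "num_rec = PrimRec (const_rec (code_tm nil_tm)) (op_rec 1 (const_rec (code_tm nil_tm)) (Proj 1))"

lemma num_rec: "rec_eval num_rec [n] (code_tm (num_tm n))"
proof (induction n)
  case 0
  show ?case by (simp add: num_rec_def rec_eval_PrimRec_0 const_rec)
next
  case (Suc n)
  have "rec_eval (op_rec 1 (const_rec (code_tm nil_tm)) (Proj 1)) [n, code_tm (num_tm n)]
      (code_tm (op_tm 1 nil_tm (num_tm n)))"
    by (intro op_rec const_rec rec_eval_Proj') simp_all
  with Suc show ?case
    unfolding num_rec_def num_tm.simps by (rule rec_eval_PrimRec_Suc)
qed

text \<open>
  On the code of the term for \<open>h = diag_rec f\<close>, \<open>h\<close> asks \<open>f\<close> whether \<open>h\<close> applied to this very code
  provably has value \<open>1\<close>, and flips the answer.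
\<close>

definition diag_rec :: "recf \<Rightarrow> recf" where
  "diag_rec f = Comp (PrimRec (const_rec 1) Zero)
    [Comp f [const_rec (code_ctx ev_ctx), const_rec (code_ty TBase),
       op_rec 0 (Proj 0) (op_rec 1 num_rec (const_rec (code_tm nil_tm))),
       const_rec (code_tm (num_tm 1))]]"

text \<open>Here \<open>t\<close> is arbitrary; self-reference arises only when it is chosen as the
  term coding \<open>diag_rec f\<close>.\<close>

lemma diag_rec:
  assumes "rec_eval f [code_ctx ev_ctx, code_ty TBase,
      code_tm (op_tm 0 t (list_tm [code_tm t])), code_tm (num_tm 1)] (if b then 1 else 0)"
  shows "rec_eval (diag_rec f) [code_tm t] (if b then 0 else 1)"
proof -
  have "rec_eval (op_rec 0 (Proj 0) (op_rec 1 num_rec (const_rec (code_tm nil_tm)))) [code_tm t]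
      (code_tm (op_tm 0 t (list_tm [code_tm t])))"
    unfolding list_tm_simps
    by (intro op_rec num_rec const_rec rec_eval_Proj') simp_all
  then have "rec_eval (Comp f [const_rec (code_ctx ev_ctx), const_rec (code_ty TBase),
       op_rec 0 (Proj 0) (op_rec 1 num_rec (const_rec (code_tm nil_tm))),
       const_rec (code_tm (num_tm 1))]) [code_tm t] (if b then 1 else 0)"
    by (intro rec_eval_Comp[OF _ assms]) (simp add: const_rec del: list_tm_simps const_rec.simps)
  \<comment> \<open>Negation on truth values: 1 at zero, and 0 at every successor.\<close>
  moreover have "rec_eval (PrimRec (const_rec 1) Zero) [if b then 1 else 0] (if b then 0 else 1)"
    using rec_eval_PrimRec_0[OF const_rec[of 1 "[]"], of Zero]
      rec_eval_PrimRec_Suc[OF rec_eval_PrimRec_0[OF const_rec[of 1 "[]"], of Zero] rec_eval_Zero]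
    by simp
  ultimately show ?thesis
    unfolding diag_rec_def by (rule rec_eval_Comp1)
qed

theorem theorem2p2: "\<not> (\<exists>f. decides_judgmental_equality f)"
proof
  assume "\<exists>f. decides_judgmental_equality f"
  then obtain f where f: "decides_judgmental_equality f" ..
  define t where "t = code_rec (diag_rec f)"
  define M where "M = op_tm 0 t (list_tm [code_tm t])"
  \<comment> \<open>Typing of \<open>M\<close> keeps the question inside the promise, so that
    \<open>f\<close> has to answer it.\<close>
  have "ev_ctx \<turnstile> IsTm M TBase"
    unfolding M_def t_def by (intro typed_intros) simp
  then have "rec_eval f [code_ctx ev_ctx, code_ty TBase, code_tm M, code_tm (num_tm 1)]
      (if M \<approx> num_tm 1 then 1 else 0)"
    using f num_typed unfolding decides_judgmental_equality_def deq_def by blast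
  then have "rec_eval (diag_rec f) [code_tm t] (if M \<approx> num_tm 1 then 0 else 1)"
    unfolding M_def by (rule diag_rec)
  \<comment> \<open>\<open>M\<close> is the term for this very computation, so the flipped answer
    becomes its provable value. If \<open>M\<close> provably has value 1, it also has value 0; if
    not, it has value 1 after all.\<close>
  from eval_complete[OF this]
  have *: "M \<approx> num_tm (if M \<approx> num_tm 1 then 0 else 1)"
    unfolding M_def t_def .
  show False
  proof (cases "M \<approx> num_tm 1")
    case True
    with * have "M \<approx> num_tm 0" by simp
    then have "num_tm 0 \<approx> num_tm 1"
      using True unfolding deq_def by (meson derivable.tm_sym derivable.tm_trans)
    then show False using num_consistent by simp
  next
    case False
    with * show False by simp
  qed
qed

end
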